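(* Let $\otimes$ be either multiplication on $[0,1]$ or the Łukasiewicz tensor $u\otimes v=\max(0,u+v-1)$ on $[0,1]$, let $\mathsf{A}$ be the category of $[0,1]$-categories associated with $\otimes$ (defined in the context), let $X$ be a partially ordered compact space and let $CX=\mathsf{PosComp}(X,[0,1]^{\mathrm{op}})$ with the pointwise structure. Let $m:A\to CX$ be an injective morphism in $\mathsf{A}$ such that the cone $(m(a):X\to[0,1]^{\mathrm{op}})_{a\in A}$ is point-separating and initial with respect to the canonical forgetful functor $\mathsf{PosComp}\to\mathsf{Set}$. Then $m$ is an isomorphism in $\mathsf{A}$ if and only if $A$ is Cauchy-complete.
   Context: **Enriched categories.** Let $\otimes$ be the given tensor on $[0,1]$ and $\hom(u,-)$ the right adjoint of $u\otimes-$: $u\otimes v\le w\iff v\le\hom(u,w)$. A $[0,1]$-category is a set $X$ with a map $a:X\times X\to[0,1]$ with $a(x,x)=1$ and $a(x,y)\otimes a(y,z)\le a(x,z)$. A $[0,1]$-functor $f:(X,a)\to(Y,b)$ is a map with $a(x,y)\le b(f(x),f(y))$. The natural order is $x\le y\iff a(x,y)=1$; $(X,a)$ is separated if this order is anti-symmetric. A $u$-copower of $x$ is an element $x\otimes u$ with $a(x\otimes u,y)=\hom(u,a(x,y))$ for all $y$; a $u$-power of $x$ is an element $x\pitchfork u$ with $a(y,x\pitchfork u)=\hom(u,a(y,x))$ for all $y$. $(X,a)$ is $[0,1]$-powered if all $u$-powers ($u\in[0,1]$) exist. $(X,a)$ is finitely cocomplete if it has all colimits of weighted diagrams with finite underlying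 set; equivalently, it has all copowers, a bottom element, and all binary suprema in the natural order, with $a(x\vee y,z)=a(x,z)\wedge a(y,z)$ for all $z$. A map between finitely cocomplete $[0,1]$-categories is a finitely cocontinuous $[0,1]$-functor iff it is monotone and preserves copowers and binary suprema. $[0,1]\text{-}\mathsf{FinSup}$ is the category of separated finitely cocomplete $[0,1]$-categories and finitely cocontinuous $[0,1]$-functors. **Cauchy-completeness.** $(X,a)$ is Cauchy-complete if, for every $[0,1]$-category $(Z,c)$, every $[0,1]$-functor $h:Z\to X$ and every right adjoint $[0,1]$-distributor $\psi$ from $Z$ to the one-point $[0,1]$-category, the $\psi$-weighted colimit of $h$ exists, i.e. there is $x_0\in X$ with $a(x_0,x)=\inf_{z\in Z}\hom(\psi(z),a(h(z),x))$ for all $x\in X$. Here $\psi:Z\to[0,1]$ is such a distributor if $c(z,z')\otimes\psi(z')\le\psi(z)$; it is right adjoint if there is $\varphi:Z\to[0,1]$ with $\varphi(z)\otimes c(z,z')\le\varphi(z')$, $\sup_z\varphi(z)\otimes\psi(z)=1$ and $\psi(z)\otimes\varphi(z')\le c(z,z')$. **The category $\mathsf{A}$.** Objects of $\mathsf{Mon}([0,1]\text{-}\mathsf{FinSup})$ are objects $X$ of $[0,1]\text{-}\mathsf{FinSup}$ with an associative commutative operation $\otimes:X\times X\to X$ whose unit is the top element $1$, such that each $x\otimes-$ is a finitely cocontinuous $[0,1]$-functor; morphisms are finitely cocontinuous $[0,1]$-functors preserving unit and multiplication. $\mathsf{Mon}_\ominus([0,1]\text{-}\mathsf{FinSup})$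 is defined likewise, but objects carry an additional action (a map) $\ominus:X\times[0,1]\to X$, no further axioms being listed, and morphisms preserve it. If $\otimes$ is the Łukasiewicz tensor, $\mathsf{A}$ has as objects the $[0,1]$-powered objects of $\mathsf{Mon}([0,1]\text{-}\mathsf{FinSup})$ and as morphisms the morphisms of $\mathsf{Mon}([0,1]\text{-}\mathsf{FinSup})$ preserving $u$-powers for all $u\in[0,1]$. If $\otimes$ is multiplication, $\mathsf{A}$ is defined in the same way with $\mathsf{Mon}_\ominus([0,1]\text{-}\mathsf{FinSup})$ in place of $\mathsf{Mon}([0,1]\text{-}\mathsf{FinSup})$. **Spaces.** A partially ordered compact space is a compact space with a partial order closed in $X\times X$ (hence Hausdorff). $\mathsf{PosComp}$ is the category of these spaces and monotone continuous maps. $[0,1]^{\mathrm{op}}$ is $[0,1]$ with the Euclidean topology and dual order; thus $CX$ is the set of continuous order-reversing maps $X\to[0,1]$, with pointwise $\vee$, $-\otimes u$, $\otimes$, $0$, $1$, powers $(\psi\pitchfork u)(x)=\hom(u,\psi(x))$, (for multiplication) $(\psi\ominus u)(x)=\max(\psi(x)-u,0)$, and structure $\inf_x\hom(\psi_1(x),\psi_2(x))$. A cone $(f_i:X\to X_i)_i$ in $\mathsf{PosComp}$ is initial with respect to $\mathsf{PosComp}\to\mathsf{Set}$ if, for every $Y$ in $\mathsf{PosComp}$, a map $g:Y\to X$ is a morphism whenever all $f_i\cdot g$ are. For a point-separating cone $L$ of morphisms $X\to[0,1]^{\mathrm{op}}$ this means: $x\ge y$ iff $\psi(x)\le\psi(y)$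 (usual order of $[0,1]$) for all $\psi\in L$. *)

theory Defs
  imports "HOL-Analysis.Analysis"
begin

section \<open>Tensors on the unit interval\<close>

text \<open>The unit interval is the subset \<open>{0..1}\<close> of the reals. Suprema and infima are those of the
  complete lattice \<open>[0,1]\<close>; adding the bottom (top) element fixes the value at the empty set.\<close>

datatype tensor = Multiplication | Lukasiewicz

fun tens :: "tensor \<Rightarrow> real \<Rightarrow> real \<Rightarrow> real" where
  "tens Multiplication u v = u * v"
| "tens Lukasiewicz u v = max 0 (u + v - 1)"

definition ihom :: "tensor \<Rightarrow> real \<Rightarrow> real \<Rightarrow> real" where
  "ihom k u w = Sup {v \<in> {0..1}. tens k u v \<le> w}"

definition inf01 :: "real set \<Rightarrow> real" where
  "inf01 S = Inf (insert 1 S)"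

definition sup01 :: "real set \<Rightarrow> real" where
  "sup01 S = Sup (insert 0 S)"

section \<open>Categories enriched in the unit interval\<close>

record 'a ucat =
  carrier :: "'a set"
  str :: "'a \<Rightarrow> 'a \<Rightarrow> real"

definition ucategory :: "tensor \<Rightarrow> ('a, 'b) ucat_scheme \<Rightarrow> bool" where
  "ucategory k X \<longleftrightarrow>
     (\<forall>x\<in>carrier X. \<forall>y\<in>carrier X. str X x y \<in> {0..1}) \<and>
     (\<forall>x\<in>carrier X. str X x x = 1) \<and>
     (\<forall>x\<in>carrier X. \<forall>y\<in>carrier X. \<forall>z\<in>carrier X.
        tens k (str X x y) (str X y z) \<le> str X x z)"

definition ufunctor :: "('a, 'b) ucat_scheme \<Rightarrow> ('c, 'd) ucat_scheme \<Rightarrow> ('a \<Rightarrow> 'c) \<Rightarrow> bool" where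
  "ufunctor X Y f \<longleftrightarrow> f \<in> carrier X \<rightarrow> carrier Y \<and>
     (\<forall>x\<in>carrier X. \<forall>y\<in>carrier X. str X x y \<le> str Y (f x) (f y))"

definition nat_le :: "('a, 'b) ucat_scheme \<Rightarrow> 'a \<Rightarrow> 'a \<Rightarrow> bool" where
  "nat_le X x y \<longleftrightarrow> str X x y = 1"

definition separated :: "('a, 'b) ucat_scheme \<Rightarrow> bool" where
  "separated X \<longleftrightarrow>
     (\<forall>x\<in>carrier X. \<forall>y\<in>carrier X. nat_le X x y \<and> nat_le X y x \<longrightarrow> x = y)"

definition is_power :: "tensor \<Rightarrow> ('a, 'b) ucat_scheme \<Rightarrow> 'a \<Rightarrow> real \<Rightarrow> 'a \<Rightarrow> bool" where
  "is_power k X x u p \<longleftrightarrow> p \<in> carrier X \<and>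
     (\<forall>y\<in>carrier X. str X y p = ihom k u (str X y x))"

definition powered :: "tensor \<Rightarrow> ('a, 'b) ucat_scheme \<Rightarrow> bool" where
  "powered k X \<longleftrightarrow> (\<forall>x\<in>carrier X. \<forall>u\<in>{0..1}. \<exists>p. is_power k X x u p)"

text \<open>A weight on \<open>Z\<close> is a distributor from \<open>Z\<close> to the one-point category.\<close>

definition weight :: "tensor \<Rightarrow> ('z, 'c) ucat_scheme \<Rightarrow> ('z \<Rightarrow> real) \<Rightarrow> bool" where
  "weight k Z \<psi> \<longleftrightarrow> \<psi> \<in> carrier Z \<rightarrow> {0..1} \<and>
     (\<forall>z\<in>carrier Z. \<forall>z'\<in>carrier Z. tens k (str Z z z') (\<psi> z') \<le> \<psi> z)"

definition coweight :: "tensor \<Rightarrow> ('z, 'c) ucat_scheme \<Rightarrow> ('z \<Rightarrow> real) \<Rightarrow> bool" where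
  "coweight k Z \<phi> \<longleftrightarrow> \<phi> \<in> carrier Z \<rightarrow> {0..1} \<and>
     (\<forall>z\<in>carrier Z. \<forall>z'\<in>carrier Z. tens k (\<phi> z) (str Z z z') \<le> \<phi> z')"

definition right_adjoint_weight :: "tensor \<Rightarrow> ('z, 'c) ucat_scheme \<Rightarrow> ('z \<Rightarrow> real) \<Rightarrow> bool" where
  "right_adjoint_weight k Z \<psi> \<longleftrightarrow> weight k Z \<psi> \<and>
     (\<exists>\<phi>. coweight k Z \<phi> \<and>
        sup01 ((\<lambda>z. tens k (\<phi> z) (\<psi> z)) ` carrier Z) = 1 \<and>
        (\<forall>z\<in>carrier Z. \<forall>z'\<in>carrier Z. tens k (\<psi> z) (\<phi> z') \<le> str Z z z'))"

definition is_colimit :: "tensor \<Rightarrow> ('a, 'b) ucat_scheme \<Rightarrow> ('z, 'c) ucat_scheme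
    \<Rightarrow> ('z \<Rightarrow> 'a) \<Rightarrow> ('z \<Rightarrow> real) \<Rightarrow> 'a \<Rightarrow> bool" where
  "is_colimit k X Z h \<psi> x0 \<longleftrightarrow> x0 \<in> carrier X \<and>
     (\<forall>x\<in>carrier X. str X x0 x = inf01 ((\<lambda>z. ihom k (\<psi> z) (str X (h z) x)) ` carrier Z))"

definition weighted_diagram :: "tensor \<Rightarrow> ('a, 'b) ucat_scheme \<Rightarrow> ('z, 'c) ucat_scheme
    \<Rightarrow> ('z \<Rightarrow> 'a) \<Rightarrow> ('z \<Rightarrow> real) \<Rightarrow> bool" where
  "weighted_diagram k X Z h \<psi> \<longleftrightarrow> ucategory k Z \<and> ufunctor Z X h \<and> weight k Z \<psi>"

subsection \<open>Finite cocompleteness\<close>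

text \<open>Index categories are taken with objects in a type \<open>'z\<close>. For finite ones \<open>nat\<close> is no
  restriction: see \<open>finitely_cocomplete_universe\<close> and \<open>finitely_cocontinuous_universe\<close> below.\<close>

definition finitely_cocomplete_over ::
    "'z itself \<Rightarrow> tensor \<Rightarrow> ('a, 'b) ucat_scheme \<Rightarrow> bool" where
  "finitely_cocomplete_over _ k X \<longleftrightarrow>
     (\<forall>(Z::'z ucat) h \<psi>. finite (carrier Z) \<and> weighted_diagram k X Z h \<psi>
        \<longrightarrow> (\<exists>x0. is_colimit k X Z h \<psi> x0))"

definition finitely_cocontinuous_over ::
    "'z itself \<Rightarrow> tensor \<Rightarrow> ('a, 'b) ucat_scheme \<Rightarrow> ('c, 'd) ucat_scheme \<Rightarrow> ('a \<Rightarrow> 'c) \<Rightarrow> bool" where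
  "finitely_cocontinuous_over _ k X Y f \<longleftrightarrow>
     (\<forall>(Z::'z ucat) h \<psi> x0. finite (carrier Z) \<and> weighted_diagram k X Z h \<psi> \<and>
        is_colimit k X Z h \<psi> x0 \<longrightarrow> is_colimit k Y Z (f \<circ> h) \<psi> (f x0))"

abbreviation finitely_cocomplete :: "tensor \<Rightarrow> ('a, 'b) ucat_scheme \<Rightarrow> bool" where
  "finitely_cocomplete \<equiv> finitely_cocomplete_over TYPE(nat)"

abbreviation finitely_cocontinuous ::
    "tensor \<Rightarrow> ('a, 'b) ucat_scheme \<Rightarrow> ('c, 'd) ucat_scheme \<Rightarrow> ('a \<Rightarrow> 'c) \<Rightarrow> bool" where
  "finitely_cocontinuous \<equiv> finitely_cocontinuous_over TYPE(nat)"

definition FinSup_obj :: "tensor \<Rightarrow> ('a, 'b) ucat_scheme \<Rightarrow> bool" where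
  "FinSup_obj k X \<longleftrightarrow> ucategory k X \<and> separated X \<and> finitely_cocomplete k X"

definition FinSup_mor ::
    "tensor \<Rightarrow> ('a, 'b) ucat_scheme \<Rightarrow> ('c, 'd) ucat_scheme \<Rightarrow> ('a \<Rightarrow> 'c) \<Rightarrow> bool" where
  "FinSup_mor k X Y f \<longleftrightarrow> ufunctor X Y f \<and> finitely_cocontinuous k X Y f"

subsection \<open>Cauchy completeness\<close>

text \<open>HOL cannot quantify over all types inside a formula. Taking the index categories with
  objects in the type of \<open>X\<close> itself is no restriction: see \<open>cauchy_complete_universe\<close> below.\<close>

definition cauchy_complete_over ::
    "'z itself \<Rightarrow> tensor \<Rightarrow> ('a, 'b) ucat_scheme \<Rightarrow> bool" where
  "cauchy_complete_over _ k X \<longleftrightarrow>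
     (\<forall>(Z::'z ucat) h \<psi>. ucategory k Z \<and> ufunctor Z X h \<and> right_adjoint_weight k Z \<psi>
        \<longrightarrow> (\<exists>x0. is_colimit k X Z h \<psi> x0))"

definition cauchy_complete :: "tensor \<Rightarrow> ('a, 'b) ucat_scheme \<Rightarrow> bool" where
  "cauchy_complete k (X :: ('a, 'b) ucat_scheme) \<longleftrightarrow> cauchy_complete_over TYPE('a) k X"

section \<open>The category A\<close>

text \<open>The component \<open>ominus\<close> belongs to the structure only for multiplication; for the
  Lukasiewicz tensor neither objects nor morphisms depend on it.\<close>

record 'a ualg = "'a ucat" +
  mult :: "'a \<Rightarrow> 'a \<Rightarrow> 'a"
  one :: 'a
  ominus :: "'a \<Rightarrow> real \<Rightarrow> 'a"

definition Mon_obj :: "tensor \<Rightarrow> 'a ualg \<Rightarrow> bool" where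
  "Mon_obj k X \<longleftrightarrow> FinSup_obj k X \<and>
     (\<forall>x\<in>carrier X. \<forall>y\<in>carrier X. mult X x y \<in> carrier X) \<and>
     (\<forall>x\<in>carrier X. \<forall>y\<in>carrier X. \<forall>z\<in>carrier X.
        mult X (mult X x y) z = mult X x (mult X y z)) \<and>
     (\<forall>x\<in>carrier X. \<forall>y\<in>carrier X. mult X x y = mult X y x) \<and>
     one X \<in> carrier X \<and>
     (\<forall>x\<in>carrier X. mult X (one X) x = x) \<and>
     (\<forall>x\<in>carrier X. nat_le X x (one X)) \<and>
     (\<forall>x\<in>carrier X. FinSup_mor k X X (mult X x))"

definition Mon_mor :: "tensor \<Rightarrow> 'a ualg \<Rightarrow> 'c ualg \<Rightarrow> ('a \<Rightarrow> 'c) \<Rightarrow> bool" where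
  "Mon_mor k X Y f \<longleftrightarrow> FinSup_mor k X Y f \<and> f (one X) = one Y \<and>
     (\<forall>x\<in>carrier X. \<forall>y\<in>carrier X. f (mult X x y) = mult Y (f x) (f y))"

definition Mon_ominus_obj :: "tensor \<Rightarrow> 'a ualg \<Rightarrow> bool" where
  "Mon_ominus_obj k X \<longleftrightarrow> Mon_obj k X \<and>
     (\<forall>x\<in>carrier X. \<forall>u\<in>{0..1}. ominus X x u \<in> carrier X)"

definition Mon_ominus_mor :: "tensor \<Rightarrow> 'a ualg \<Rightarrow> 'c ualg \<Rightarrow> ('a \<Rightarrow> 'c) \<Rightarrow> bool" where
  "Mon_ominus_mor k X Y f \<longleftrightarrow> Mon_mor k X Y f \<and>
     (\<forall>x\<in>carrier X. \<forall>u\<in>{0..1}. f (ominus X x u) = ominus Y (f x) u)"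

definition preserves_powers :: "tensor \<Rightarrow> 'a ualg \<Rightarrow> 'c ualg \<Rightarrow> ('a \<Rightarrow> 'c) \<Rightarrow> bool" where
  "preserves_powers k X Y f \<longleftrightarrow>
     (\<forall>x\<in>carrier X. \<forall>u\<in>{0..1}. \<forall>p. is_power k X x u p \<longrightarrow> is_power k Y (f x) u (f p))"

definition A_obj :: "tensor \<Rightarrow> 'a ualg \<Rightarrow> bool" where
  "A_obj k X \<longleftrightarrow> powered k X \<and>
     (case k of Lukasiewicz \<Rightarrow> Mon_obj k X | Multiplication \<Rightarrow> Mon_ominus_obj k X)"

definition A_mor :: "tensor \<Rightarrow> 'a ualg \<Rightarrow> 'c ualg \<Rightarrow> ('a \<Rightarrow> 'c) \<Rightarrow> bool" where
  "A_mor k X Y f \<longleftrightarrow> preserves_powers k X Y f \<and>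
     (case k of Lukasiewicz \<Rightarrow> Mon_mor k X Y f | Multiplication \<Rightarrow> Mon_ominus_mor k X Y f)"

definition A_iso :: "tensor \<Rightarrow> 'a ualg \<Rightarrow> 'c ualg \<Rightarrow> ('a \<Rightarrow> 'c) \<Rightarrow> bool" where
  "A_iso k X Y f \<longleftrightarrow> A_mor k X Y f \<and>
     (\<exists>g. A_mor k Y X g \<and> (\<forall>x\<in>carrier X. g (f x) = x) \<and> (\<forall>y\<in>carrier Y. f (g y) = y))"

section \<open>Partially ordered compact spaces\<close>

record 'x pospace =
  ptop :: "'x topology"
  pord :: "('x \<times> 'x) set"

definition pos_comp :: "'x pospace \<Rightarrow> bool" where
  "pos_comp X \<longleftrightarrow> compact_space (ptop X) \<and> partial_order_on (topspace (ptop X)) (pord X) \<and>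
     closedin (prod_topology (ptop X) (ptop X)) (pord X)"

definition pos_mor :: "'x pospace \<Rightarrow> 'y pospace \<Rightarrow> ('x \<Rightarrow> 'y) \<Rightarrow> bool" where
  "pos_mor X Y f \<longleftrightarrow> continuous_map (ptop X) (ptop Y) f \<and>
     (\<forall>(x, y)\<in>pord X. (f x, f y) \<in> pord Y)"

definition unit_op :: "real pospace" where
  "unit_op = \<lparr>ptop = top_of_set {0..1}, pord = {(u, v). u \<in> {0..1} \<and> v \<in> {0..1} \<and> v \<le> u}\<rparr>"

definition point_separating :: "'x pospace \<Rightarrow> 'i set \<Rightarrow> ('i \<Rightarrow> 'x \<Rightarrow> 'y) \<Rightarrow> bool" where
  "point_separating X I f \<longleftrightarrow>
     (\<forall>x\<in>topspace (ptop X). \<forall>y\<in>topspace (ptop X). (\<forall>i\<in>I. f i x = f i y) \<longrightarrow> x = y)"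

text \<open>The test objects \<open>Y\<close> are taken with points in a type \<open>'y\<close>. The type of \<open>X\<close> itself
  is no restriction: see \<open>initial_cone_universe\<close> below.\<close>

definition initial_cone_over ::
    "'y itself \<Rightarrow> 'x pospace \<Rightarrow> 'i set \<Rightarrow> ('i \<Rightarrow> 'v pospace) \<Rightarrow> ('i \<Rightarrow> 'x \<Rightarrow> 'v) \<Rightarrow> bool" where
  "initial_cone_over _ X I D f \<longleftrightarrow>
     (\<forall>i\<in>I. pos_mor X (D i) (f i)) \<and>
     (\<forall>(Y::'y pospace) g. pos_comp Y \<and> g \<in> topspace (ptop Y) \<rightarrow> topspace (ptop X) \<and>
        (\<forall>i\<in>I. pos_mor Y (D i) (f i \<circ> g)) \<longrightarrow> pos_mor Y X g)"

definition initial_cone ::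
    "'x pospace \<Rightarrow> 'i set \<Rightarrow> ('i \<Rightarrow> 'v pospace) \<Rightarrow> ('i \<Rightarrow> 'x \<Rightarrow> 'v) \<Rightarrow> bool" where
  "initial_cone (X :: 'x pospace) I D f \<longleftrightarrow> initial_cone_over TYPE('x) X I D f"

text \<open>The algebra \<open>CX\<close>. Its elements are extensional functions, so that equality in HOL is
  equality of maps on \<open>X\<close>. Suprema, copowers and powers are determined by \<open>str\<close>.\<close>

definition C_alg :: "tensor \<Rightarrow> 'x pospace \<Rightarrow> ('x \<Rightarrow> real) ualg" where
  "C_alg k X = \<lparr>
     carrier = {\<psi> \<in> extensional (topspace (ptop X)). pos_mor X unit_op \<psi>},
     str = (\<lambda>\<psi>\<^sub>1 \<psi>\<^sub>2. inf01 ((\<lambda>x. ihom k (\<psi>\<^sub>1 x) (\<psi>\<^sub>2 x)) ` topspace (ptop X))),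
     mult = (\<lambda>\<psi>\<^sub>1 \<psi>\<^sub>2. \<lambda>x\<in>topspace (ptop X). tens k (\<psi>\<^sub>1 x) (\<psi>\<^sub>2 x)),
     one = (\<lambda>x\<in>topspace (ptop X). 1),
     ominus = (\<lambda>\<psi> u. \<lambda>x\<in>topspace (ptop X). max (\<psi> x - u) 0)\<rparr>"

section \<open>Independence of the index types\<close>

lemma tens_comm: "tens k u v = tens k v u"
  by (cases k) auto

lemma tens_range: "u \<in> {0..1} \<Longrightarrow> v \<in> {0..1} \<Longrightarrow> tens k u v \<in> {0..1}"
  by (cases k) (auto intro: mult_le_one)

lemma tens_assoc:
  "\<lbrakk>u \<in> {0..1}; v \<in> {0..1}; w \<in> {0..1}\<rbrakk> \<Longrightarrow> tens k (tens k u v) w = tens k u (tens k v w)"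
  by (cases k) auto

lemma tens_mono: "\<lbrakk>u \<in> {0..1}; u' \<in> {0..1}; v \<in> {0..1}; v' \<in> {0..1}; u \<le> u'; v \<le> v'\<rbrakk>
  \<Longrightarrow> tens k u v \<le> tens k u' v'"
  by (cases k) (auto intro: mult_mono)

lemma tens_one: "u \<in> {0..1} \<Longrightarrow> tens k 1 u = u" "u \<in> {0..1} \<Longrightarrow> tens k u 1 = u"
  by (cases k; auto)+

lemma ihom_Multiplication:
  assumes "u \<in> {0..1}" "w \<in> {0..1}"
  shows "ihom Multiplication u w = (if u \<le> w then 1 else w / u)"
  unfolding ihom_def
proof (rule cSup_eq_maximum)
  show "(if u \<le> w then 1 else w / u) \<in> {v \<in> {0..1}. tens Multiplication u v \<le> w}"
    using assms by (auto simp: divide_simps)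
qed (use assms in \<open>auto simp: divide_simps mult.commute\<close>)

lemma ihom_Lukasiewicz:
  assumes "u \<in> {0..1}" "w \<in> {0..1}"
  shows "ihom Lukasiewicz u w = min 1 (1 - u + w)"
  unfolding ihom_def by (rule cSup_eq_maximum) (use assms in auto)

lemma ihom_adj:
  assumes "u \<in> {0..1}" "v \<in> {0..1}" "w \<in> {0..1}"
  shows "tens k u v \<le> w \<longleftrightarrow> v \<le> ihom k u w"
proof (cases k)
  case Multiplication
  have "u * v \<le> w" if "u \<le> w"
    using assms that by (metis atLeastAtMost_iff mult_left_le order_trans)
  with Multiplication show ?thesis
    using assms by (auto simp: ihom_Multiplication divide_simps mult.commute)
next
  case Lukasiewicz
  with assms show ?thesis by (auto simp: ihom_Lukasiewicz)
qed

lemma ihom_range: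
  assumes "u \<in> {0..1}" "w \<in> {0..1}"
  shows "ihom k u w \<in> {0..1}"
  using assms by (cases k) (auto simp: ihom_Multiplication ihom_Lukasiewicz)

lemma inf01_ge_iff:
  assumes "S \<subseteq> {0..1}" "v \<le> 1"
  shows "v \<le> inf01 S \<longleftrightarrow> (\<forall>s\<in>S. v \<le> s)"
proof -
  have "bdd_below (insert 1 S)" using assms by (intro bdd_belowI[of _ 0]) auto
  with assms show ?thesis unfolding inf01_def by (subst le_cInf_iff) auto
qed

lemma sup01_le_iff:
  assumes "S \<subseteq> {0..1}" "0 \<le> v"
  shows "sup01 S \<le> v \<longleftrightarrow> (\<forall>s\<in>S. s \<le> v)"
proof -
  have "bdd_above (insert 0 S)" using assms by (intro bdd_aboveI[of _ 1]) auto
  with assms show ?thesis unfolding sup01_def by (subst cSup_le_iff) auto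
qed

lemma inf01_range: "S \<subseteq> {0..1} \<Longrightarrow> inf01 S \<in> {0..1}"
  using inf01_ge_iff[of S 0] inf01_ge_iff[of S "inf01 S"]
  by (auto simp: inf01_def intro!: cInf_lower bdd_belowI[of _ 0])

lemma sup01_range: "S \<subseteq> {0..1} \<Longrightarrow> sup01 S \<in> {0..1}"
  using sup01_le_iff[of S 1]
  by (auto simp: sup01_def intro!: cSup_upper bdd_aboveI[of _ 1])

lemma sup01_upper: "S \<subseteq> {0..1} \<Longrightarrow> s \<in> S \<Longrightarrow> s \<le> sup01 S"
  using sup01_le_iff[of S "sup01 S"] sup01_range[of S] by auto

lemma tens_sup01_le_iff:
  assumes "S \<subseteq> {0..1}" "u \<in> {0..1}" "w \<in> {0..1}"
  shows "tens k u (sup01 S) \<le> w \<longleftrightarrow> (\<forall>s\<in>S. tens k u s \<le> w)"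
proof -
  have "tens k u (sup01 S) \<le> w \<longleftrightarrow> sup01 S \<le> ihom k u w"
    using assms by (intro ihom_adj sup01_range) auto
  also have "\<dots> \<longleftrightarrow> (\<forall>s\<in>S. s \<le> ihom k u w)"
    using assms ihom_range[of u w k] by (intro sup01_le_iff) auto
  also have "\<dots> \<longleftrightarrow> (\<forall>s\<in>S. tens k u s \<le> w)"
    using assms by (intro ball_cong refl ihom_adj[symmetric]) auto
  finally show ?thesis .
qed

theorem cauchy_complete_universe:
  fixes X :: "('a, 'b) ucat_scheme"
  assumes X: "ucategory k X" and cc: "cauchy_complete k X"
  shows "cauchy_complete_over TYPE('z) k X"
  unfolding cauchy_complete_over_def
proof (intro allI impI, elim conjE)
  fix Z :: "'z ucat" and h \<psi>
  assume Z: "ucategory k Z" and h: "ufunctor Z X h" and "right_adjoint_weight k Z \<psi>"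
  then obtain \<phi> where \<psi>: "weight k Z \<psi>" and \<phi>: "coweight k Z \<phi>"
    and sup: "sup01 ((\<lambda>z. tens k (\<phi> z) (\<psi> z)) ` carrier Z) = 1"
    and le: "\<And>z z'. z \<in> carrier Z \<Longrightarrow> z' \<in> carrier Z \<Longrightarrow> tens k (\<psi> z) (\<phi> z') \<le> str Z z z'"
    unfolding right_adjoint_weight_def by blast
  let ?I = "{0..1::real}" and ?a = "str X"
  have h1: "h z \<in> carrier X" if "z \<in> carrier Z" for z
    using h that by (auto simp: ufunctor_def)
  have h2: "str Z z z' \<le> ?a (h z) (h z')" if "z \<in> carrier Z" "z' \<in> carrier Z" for z z'
    using h that by (auto simp: ufunctor_def)
  have aI: "?a x y \<in> ?I" if "x \<in> carrier X" "y \<in> carrier X" for x y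
    using X that unfolding ucategory_def by blast
  have cI: "str Z x y \<in> ?I" if "x \<in> carrier Z" "y \<in> carrier Z" for x y
    using Z that unfolding ucategory_def by blast
  have a1: "?a x x = 1" if "x \<in> carrier X" for x using X that by (auto simp: ucategory_def)
  have at: "tens k (?a x y) (?a y z) \<le> ?a x z"
    if "x \<in> carrier X" "y \<in> carrier X" "z \<in> carrier X" for x y z
    using X that by (auto simp: ucategory_def)
  have \<psi>I: "\<psi> z \<in> ?I" if "z \<in> carrier Z" for z
    using \<psi> that unfolding weight_def by blast
  have \<phi>I: "\<phi> z \<in> ?I" if "z \<in> carrier Z" for z
    using \<phi> that unfolding coweight_def by blast
  define P where "P x = (\<lambda>z. tens k (?a x (h z)) (\<psi> z)) ` carrier Z" for x
  define Q where "Q x = (\<lambda>z. tens k (\<phi> z) (?a (h z) x)) ` carrier Z" for x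
  define p where "p x = sup01 (P x)" for x
  define q where "q x = sup01 (Q x)" for x
  have PI: "P x \<subseteq> ?I" if "x \<in> carrier X" for x
    using that by (auto simp only: P_def intro!: tens_range aI \<psi>I h1)
  have QI: "Q x \<subseteq> ?I" if "x \<in> carrier X" for x
    using that by (auto simp only: Q_def intro!: tens_range aI \<phi>I h1)
  have pI: "p x \<in> ?I" and qI: "q x \<in> ?I" if "x \<in> carrier X" for x
    unfolding p_def q_def using sup01_range PI QI that by auto
  have pu: "tens k (?a x (h z)) (\<psi> z) \<le> p x" if "x \<in> carrier X" "z \<in> carrier Z" for x z
    unfolding p_def by (rule sup01_upper[OF PI]) (use that in \<open>auto simp: P_def\<close>)
  have qu: "tens k (\<phi> z) (?a (h z) x) \<le> q x" if "x \<in> carrier X" "z \<in> carrier Z" for x z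
    unfolding q_def by (rule sup01_upper[OF QI]) (use that in \<open>auto simp: Q_def\<close>)
  have pl: "tens k u (p x) \<le> w \<longleftrightarrow> (\<forall>z\<in>carrier Z. tens k u (tens k (?a x (h z)) (\<psi> z)) \<le> w)"
    if "x \<in> carrier X" "u \<in> ?I" "w \<in> ?I" for x u w
    unfolding p_def using tens_sup01_le_iff[OF PI[OF that(1)] that(2,3)] by (simp add: P_def)
  have ql: "tens k u (q x) \<le> w \<longleftrightarrow> (\<forall>z\<in>carrier Z. tens k u (tens k (\<phi> z) (?a (h z) x)) \<le> w)"
    if "x \<in> carrier X" "u \<in> ?I" "w \<in> ?I" for x u w
    unfolding q_def using tens_sup01_le_iff[OF QI[OF that(1)] that(2,3)] by (simp add: Q_def)
  define X' :: "'a ucat" where "X' = \<lparr>carrier = carrier X, str = ?a\<rparr>"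
  have X': "carrier X' = carrier X" "str X' = ?a" by (simp_all add: X'_def)
  have "ucategory k X'" using X by (simp add: ucategory_def X')
  moreover have "ufunctor X' X id" by (simp add: ufunctor_def X')
  moreover have "right_adjoint_weight k X' p"
    unfolding right_adjoint_weight_def
  proof (intro conjI exI[of _ q])
    show "weight k X' p"
      unfolding weight_def X'
    proof (intro conjI ballI)
      fix x y assume xy: "x \<in> carrier X" "y \<in> carrier X"
      show "tens k (?a x y) (p y) \<le> p x"
      proof (subst pl[OF xy(2) aI[OF xy] pI[OF xy(1)]], intro ballI)
        fix z assume z: "z \<in> carrier Z"
        have "tens k (?a x y) (tens k (?a y (h z)) (\<psi> z))
            = tens k (tens k (?a x y) (?a y (h z))) (\<psi> z)"
          using xy z by (intro tens_assoc[symmetric] aI h1 \<psi>I)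
        also have "\<dots> \<le> tens k (?a x (h z)) (\<psi> z)"
          using xy z by (intro tens_mono tens_range aI h1 \<psi>I at order_refl)
        also have "\<dots> \<le> p x" using xy z by (intro pu)
        finally show "tens k (?a x y) (tens k (?a y (h z)) (\<psi> z)) \<le> p x" .
      qed
    qed (use pI in auto)
    show "coweight k X' q"
      unfolding coweight_def X'
    proof (intro conjI ballI)
      fix x y assume xy: "x \<in> carrier X" "y \<in> carrier X"
      show "tens k (q x) (?a x y) \<le> q y"
      proof (subst tens_comm, subst ql[OF xy(1) aI[OF xy] qI[OF xy(2)]], intro ballI)
        fix z assume z: "z \<in> carrier Z"
        have "tens k (?a x y) (tens k (\<phi> z) (?a (h z) x))
            = tens k (\<phi> z) (tens k (?a (h z) x) (?a x y))"
          using xy z by (subst tens_comm) (intro tens_assoc aI h1 \<phi>I)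
        also have "\<dots> \<le> tens k (\<phi> z) (?a (h z) y)"
          using xy z by (intro tens_mono tens_range aI h1 \<phi>I at order_refl)
        also have "\<dots> \<le> q y" using xy z by (intro qu)
        finally show "tens k (?a x y) (tens k (\<phi> z) (?a (h z) x)) \<le> q y" .
      qed
    qed (use qI in auto)
    let ?S = "(\<lambda>x. tens k (q x) (p x)) ` carrier X'"
    have SI: "?S \<subseteq> ?I" by (auto simp only: X' intro!: tens_range qI pI)
    have "sup01 ((\<lambda>z. tens k (\<phi> z) (\<psi> z)) ` carrier Z) \<le> sup01 ?S"
    proof (subst sup01_le_iff)
      show "(\<lambda>z. tens k (\<phi> z) (\<psi> z)) ` carrier Z \<subseteq> ?I"
        by (auto simp only: intro!: tens_range \<phi>I \<psi>I)
      show "0 \<le> sup01 ?S" using sup01_range[OF SI] by auto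
      show "\<forall>s\<in>(\<lambda>z. tens k (\<phi> z) (\<psi> z)) ` carrier Z. s \<le> sup01 ?S"
      proof safe
        fix z assume z: "z \<in> carrier Z"
        have "\<psi> z \<le> p (h z)" using pu[OF h1[OF z] z] z by (simp only: a1 h1 tens_one \<psi>I)
        moreover have "\<phi> z \<le> q (h z)" using qu[OF h1[OF z] z] z by (simp only: a1 h1 tens_one \<phi>I)
        ultimately have "tens k (\<phi> z) (\<psi> z) \<le> tens k (q (h z)) (p (h z))"
          using z by (intro tens_mono \<phi>I \<psi>I pI qI h1)
        also have "\<dots> \<le> sup01 ?S"
          by (rule sup01_upper[OF SI]) (use z h1 in \<open>auto simp: X'\<close>)
        finally show "tens k (\<phi> z) (\<psi> z) \<le> sup01 ?S" .
      qed
    qed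
    then show "sup01 ?S = 1" using sup sup01_range[OF SI] by auto
    show "\<forall>x\<in>carrier X'. \<forall>y\<in>carrier X'. tens k (p x) (q y) \<le> str X' x y"
      unfolding X'
    proof (intro ballI)
      fix x y assume xy: "x \<in> carrier X" "y \<in> carrier X"
      show "tens k (p x) (q y) \<le> ?a x y"
      proof (subst ql[OF xy(2) pI[OF xy(1)] aI[OF xy]], intro ballI)
        fix z' assume z': "z' \<in> carrier Z"
        have r: "tens k (\<phi> z') (?a (h z') y) \<in> ?I" using xy z' by (intro tens_range \<phi>I aI h1)
        show "tens k (p x) (tens k (\<phi> z') (?a (h z') y)) \<le> ?a x y"
        proof (subst tens_comm, subst pl[OF xy(1) r aI[OF xy]], intro ballI)
          fix z assume z: "z \<in> carrier Z"
          let ?u = "?a x (h z)" and ?v = "?a (h z') y"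
          have uI: "?u \<in> ?I" "?v \<in> ?I" using xy z z' by (auto simp only: intro!: aI h1)
          note I = uI \<psi>I[OF z] \<phi>I[OF z'] aI[OF h1[OF z] h1[OF z']] cI[OF z z']
          have "tens k (tens k (\<phi> z') ?v) (tens k ?u (\<psi> z))
              = tens k (tens k ?u (\<psi> z)) (tens k (\<phi> z') ?v)" by (rule tens_comm)
          also have "\<dots> = tens k (tens k ?u (tens k (\<psi> z) (\<phi> z'))) ?v"
            by (simp only: tens_assoc I tens_range)
          also have "\<dots> \<le> tens k (tens k ?u (?a (h z) (h z'))) ?v"
            using le[OF z z'] h2[OF z z'] I by (intro tens_mono tens_range order_refl) auto
          also have "\<dots> \<le> tens k (?a x (h z')) ?v"
            using xy z z' I by (intro tens_mono tens_range aI h1 at order_refl)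
          also have "\<dots> \<le> ?a x y" using xy z' by (intro at h1)
          finally show "tens k (tens k (\<phi> z') ?v) (tens k ?u (\<psi> z)) \<le> ?a x y" .
        qed
      qed
    qed
  qed
  ultimately obtain x0 where x0: "is_colimit k X X' id p x0"
    using cc unfolding cauchy_complete_def cauchy_complete_over_def by blast
  have "inf01 ((\<lambda>y. ihom k (p y) (?a y x)) ` carrier X)
      = inf01 ((\<lambda>z. ihom k (\<psi> z) (?a (h z) x)) ` carrier Z)" (is "?l = ?r")
    if x: "x \<in> carrier X" for x
  proof -
    have S: "(\<lambda>y. ihom k (p y) (?a y x)) ` carrier X \<subseteq> ?I"
      using x by (auto simp only: intro!: ihom_range pI aI)
    have T: "(\<lambda>z. ihom k (\<psi> z) (?a (h z) x)) ` carrier Z \<subseteq> ?I"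
      using x by (auto simp only: intro!: ihom_range \<psi>I aI h1)
    have "v \<le> ?l \<longleftrightarrow> v \<le> ?r" if v: "v \<in> ?I" for v
    proof -
      have "v \<le> ?l \<longleftrightarrow> (\<forall>y\<in>carrier X. v \<le> ihom k (p y) (?a y x))"
        using inf01_ge_iff[OF S] v by simp
      also have "\<dots> \<longleftrightarrow> (\<forall>y\<in>carrier X. tens k (p y) v \<le> ?a y x)"
        using v x by (intro ball_cong refl ihom_adj[symmetric] pI aI)
      also have "\<dots> \<longleftrightarrow> (\<forall>y\<in>carrier X. \<forall>z\<in>carrier Z.
          tens k v (tens k (?a y (h z)) (\<psi> z)) \<le> ?a y x)"
        using v x by (subst tens_comm) (intro ball_cong refl pl aI)
      also have "\<dots> \<longleftrightarrow> (\<forall>z\<in>carrier Z. tens k (\<psi> z) v \<le> ?a (h z) x)"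
      proof safe
        fix z assume z: "z \<in> carrier Z"
          and "\<forall>y\<in>carrier X. \<forall>z\<in>carrier Z. tens k v (tens k (?a y (h z)) (\<psi> z)) \<le> ?a y x"
        then have "tens k v (tens k (?a (h z) (h z)) (\<psi> z)) \<le> ?a (h z) x"
          using h1 by blast
        then have "tens k v (\<psi> z) \<le> ?a (h z) x" using z by (simp only: a1 h1 tens_one \<psi>I)
        then show "tens k (\<psi> z) v \<le> ?a (h z) x" by (simp only: tens_comm)
      next
        fix y z assume y: "y \<in> carrier X" and z: "z \<in> carrier Z"
          and *: "\<forall>z\<in>carrier Z. tens k (\<psi> z) v \<le> ?a (h z) x"
        have I: "?a y (h z) \<in> ?I" using y z by (intro aI h1)
        have "tens k v (tens k (?a y (h z)) (\<psi> z)) = tens k (tens k (?a y (h z)) (\<psi> z)) v"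
          by (rule tens_comm)
        also have "\<dots> = tens k (?a y (h z)) (tens k (\<psi> z) v)"
          using y z v by (intro tens_assoc I \<psi>I)
        also have "\<dots> \<le> tens k (?a y (h z)) (?a (h z) x)"
          using x y z v * by (intro tens_mono tens_range I \<psi>I aI h1 order_refl) auto
        also have "\<dots> \<le> ?a y x" using x y z by (intro at h1)
        finally show "tens k v (tens k (?a y (h z)) (\<psi> z)) \<le> ?a y x" .
      qed
      also have "\<dots> \<longleftrightarrow> (\<forall>z\<in>carrier Z. v \<le> ihom k (\<psi> z) (?a (h z) x))"
        using v x by (intro ball_cong refl ihom_adj \<psi>I aI h1)
      also have "\<dots> \<longleftrightarrow> v \<le> ?r" using inf01_ge_iff[OF T] v by simp
      finally show ?thesis .
    qed
    from this[of ?l] this[of ?r] show ?thesis using inf01_range[OF S] inf01_range[OF T] by auto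
  qed
  then have "is_colimit k X Z h \<psi> x0" using x0 by (simp add: is_colimit_def X')
  then show "\<exists>x0. is_colimit k X Z h \<psi> x0" ..
qed

text \<open>Every finite weighted diagram is isomorphic to one indexed by natural numbers.\<close>

lemma finite_diagram_nat:
  fixes Z :: "'z ucat"
  assumes "finite (carrier Z)" and d: "weighted_diagram k X Z h \<psi>"
  obtains Z' :: "nat ucat" and e where "finite (carrier Z')"
    and "weighted_diagram k X Z' (h \<circ> e) (\<psi> \<circ> e)" and "carrier Z = e ` carrier Z'"
proof -
  obtain e :: "nat \<Rightarrow> 'z" and n where e: "carrier Z = e ` {i. i < n}" "inj_on e {i. i < n}"
    using assms(1) finite_imp_nat_seg_image_inj_on by metis
  define Z' where "Z' = \<lparr>carrier = {i. i < n}, str = (\<lambda>i j. str Z (e i) (e j))\<rparr>"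
  show ?thesis
  proof
    show "weighted_diagram k X Z' (h \<circ> e) (\<psi> \<circ> e)"
      using d unfolding weighted_diagram_def ucategory_def ufunctor_def weight_def e(1) Z'_def
      by (auto simp: Pi_iff)
  qed (use e in \<open>auto simp: Z'_def\<close>)
qed

theorem finitely_cocomplete_universe:
  assumes "finitely_cocomplete k X"
  shows "finitely_cocomplete_over TYPE('z) k X"
  unfolding finitely_cocomplete_over_def
proof (intro allI impI, elim conjE)
  fix Z :: "'z ucat" and h \<psi>
  assume "finite (carrier Z)" "weighted_diagram k X Z h \<psi>"
  then obtain Z' :: "nat ucat" and e where Z': "finite (carrier Z')"
    "weighted_diagram k X Z' (h \<circ> e) (\<psi> \<circ> e)" "carrier Z = e ` carrier Z'"
    by (rule finite_diagram_nat)
  then obtain x0 where "is_colimit k X Z' (h \<circ> e) (\<psi> \<circ> e) x0"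
    using assms unfolding finitely_cocomplete_over_def by blast
  then have "is_colimit k X Z h \<psi> x0" by (simp add: is_colimit_def Z'(3) image_image)
  then show "\<exists>x0. is_colimit k X Z h \<psi> x0" ..
qed

theorem finitely_cocontinuous_universe:
  assumes "finitely_cocontinuous k X Y f"
  shows "finitely_cocontinuous_over TYPE('z) k X Y f"
  unfolding finitely_cocontinuous_over_def
proof (intro allI impI, elim conjE)
  fix Z :: "'z ucat" and h \<psi> x0
  assume "finite (carrier Z)" "weighted_diagram k X Z h \<psi>" and x0: "is_colimit k X Z h \<psi> x0"
  then obtain Z' :: "nat ucat" and e where Z': "finite (carrier Z')"
    "weighted_diagram k X Z' (h \<circ> e) (\<psi> \<circ> e)" "carrier Z = e ` carrier Z'"
    using finite_diagram_nat by metis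
  have "is_colimit k X Z' (h \<circ> e) (\<psi> \<circ> e) x0"
    using x0 by (simp add: is_colimit_def Z'(3) image_image)
  then have "is_colimit k Y Z' (f \<circ> (h \<circ> e)) (\<psi> \<circ> e) (f x0)"
    using assms Z'(1,2) unfolding finitely_cocontinuous_over_def by blast
  then show "is_colimit k Y Z (f \<circ> h) \<psi> (f x0)"
    by (simp add: is_colimit_def Z'(3) image_image)
qed

lemma pos_comp_Hausdorff:
  assumes "pos_comp X"
  shows "Hausdorff_space (ptop X)"
proof -
  let ?T = "ptop X"
  let ?swap = "\<lambda>(x, y). (y, x)"
  have po: "pord X \<subseteq> topspace ?T \<times> topspace ?T" "refl_on (topspace ?T) (pord X)" "antisym (pord X)"
    and cl: "closedin (prod_topology ?T ?T) (pord X)"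
    using assms by (auto simp: pos_comp_def partial_order_on_def preorder_on_def)
  have "continuous_map (prod_topology ?T ?T) (prod_topology ?T ?T) (\<lambda>p. (snd p, fst p))"
    by (intro continuous_map_pairedI continuous_map_fst continuous_map_snd)
  from closedin_continuous_map_preimage[OF this cl]
  have "closedin (prod_topology ?T ?T)
      (pord X \<inter> {p \<in> topspace (prod_topology ?T ?T). (snd p, fst p) \<in> pord X})"
    by (intro closedin_Int cl)
  moreover have "pord X \<inter> {p \<in> topspace (prod_topology ?T ?T). (snd p, fst p) \<in> pord X}
      = (\<lambda>x. (x, x)) ` topspace ?T"
    using po by (auto simp: refl_on_def antisym_def)
  ultimately show ?thesis unfolding Hausdorff_space_closedin_diagonal by simp
qed

lemma initial_cone_order:
  assumes X: "pos_comp X" and D: "\<And>i. i \<in> I \<Longrightarrow> pos_comp (D i)"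
    and ini: "initial_cone X I D f"
    and xy: "x \<in> topspace (ptop X)" "y \<in> topspace (ptop X)"
    and le: "\<And>i. i \<in> I \<Longrightarrow> (f i x, f i y) \<in> pord (D i)"
  shows "(x, y) \<in> pord X"
proof (cases "x = y")
  case True
  with X xy show ?thesis
    by (auto simp: pos_comp_def partial_order_on_def preorder_on_def refl_on_def)
next
  case False
  define Y where "Y = \<lparr>ptop = discrete_topology {x, y}, pord = {(x, x), (y, y), (x, y)}\<rparr>"
  have "pos_comp Y"
    using False unfolding pos_comp_def Y_def partial_order_on_def preorder_on_def
    by (auto simp: compact_space_discrete_topology refl_on_def trans_def antisym_def
        simp flip: prod_topology_discrete_topology)
  moreover have "id \<in> topspace (ptop Y) \<rightarrow> topspace (ptop X)" using xy by (auto simp: Y_def)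
  moreover have "pos_mor Y (D i) (f i \<circ> id)" if i: "i \<in> I" for i
  proof -
    have "f i x \<in> topspace (ptop (D i))" "f i y \<in> topspace (ptop (D i))"
      "refl_on (topspace (ptop (D i))) (pord (D i))"
      using D[OF i] le[OF i] by (auto simp: pos_comp_def partial_order_on_def preorder_on_def)
    then show ?thesis using le[OF i] by (auto simp: pos_mor_def Y_def refl_on_def)
  qed
  ultimately have "pos_mor Y X id"
    using ini unfolding initial_cone_def initial_cone_over_def by blast
  then show ?thesis by (auto simp: pos_mor_def Y_def)
qed

lemma initial_coneI:
  fixes X :: "'x pospace"
  assumes X: "pos_comp X" and D: "\<And>i. i \<in> I \<Longrightarrow> pos_comp (D i)"
    and mor: "\<And>i. i \<in> I \<Longrightarrow> pos_mor X (D i) (f i)"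
    and ord: "\<And>x y. \<lbrakk>x \<in> topspace (ptop X); y \<in> topspace (ptop X);
      \<And>i. i \<in> I \<Longrightarrow> (f i x, f i y) \<in> pord (D i)\<rbrakk> \<Longrightarrow> (x, y) \<in> pord X"
  shows "initial_cone_over TYPE('y) X I D f"
  unfolding initial_cone_over_def
proof (intro conjI ballI mor allI impI, assumption, elim conjE)
  fix Y :: "'y pospace" and g
  assume Y: "pos_comp Y" and g: "g \<in> topspace (ptop Y) \<rightarrow> topspace (ptop X)"
    and fg: "\<forall>i\<in>I. pos_mor Y (D i) (f i \<circ> g)"
  let ?P = "product_topology (\<lambda>i. ptop (D i)) I"
  define F where "F x = (\<lambda>i\<in>I. f i x)" for x
  have contF: "continuous_map (ptop X) ?P F"
    using mor by (auto simp: continuous_map_componentwise F_def pos_mor_def)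
  have contFg: "continuous_map (ptop Y) ?P (F \<circ> g)"
    using fg by (auto simp: continuous_map_componentwise F_def pos_mor_def o_def)
  have "Hausdorff_space ?P"
    using D pos_comp_Hausdorff by (auto simp: Hausdorff_space_product_topology)
  then have "closed_map (ptop X) ?P F"
    using X contF by (intro continuous_imp_closed_map) (auto simp: pos_comp_def)
  have injF: "x = y" if "x \<in> topspace (ptop X)" "y \<in> topspace (ptop X)" "F x = F y" for x y
  proof -
    have eq: "f i x = f i y" if "i \<in> I" for i using \<open>F x = F y\<close> that by (metis F_def restrict_apply')
    have r: "(f i z, f i z) \<in> pord (D i)" if "i \<in> I" "z \<in> topspace (ptop X)" for i z
      using D[OF that(1)] mor[OF that(1)] that(2)
      by (auto simp: pos_comp_def partial_order_on_def preorder_on_def refl_on_def pos_mor_def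
          dest!: continuous_map_funspace dest: funcset_mem)
    have "(x, y) \<in> pord X" "(y, x) \<in> pord X" using that eq r by (metis ord)+
    then show ?thesis
      using X by (auto simp: pos_comp_def partial_order_on_def antisym_def)
  qed
  have "continuous_map (ptop Y) (ptop X) g"
    unfolding continuous_map_closedin
  proof (intro conjI allI impI ballI)
    fix C assume C: "closedin (ptop X) C"
    then have "closedin ?P (F ` C)" using \<open>closed_map (ptop X) ?P F\<close> by (simp add: closed_map_def)
    then have "closedin (ptop Y) {y \<in> topspace (ptop Y). (F \<circ> g) y \<in> F ` C}"
      by (rule closedin_continuous_map_preimage[OF contFg])
    moreover have "{y \<in> topspace (ptop Y). (F \<circ> g) y \<in> F ` C} = {y \<in> topspace (ptop Y). g y \<in> C}"
      using injF g closedin_subset[OF C] by (auto; blast)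
    ultimately show "closedin (ptop Y) {y \<in> topspace (ptop Y). g y \<in> C}" by simp
  qed (use g in auto)
  moreover have "(g x, g y) \<in> pord X" if xy: "(x, y) \<in> pord Y" for x y
  proof (rule ord)
    have "x \<in> topspace (ptop Y)" "y \<in> topspace (ptop Y)"
      using Y xy by (auto simp: pos_comp_def partial_order_on_def preorder_on_def)
    with g show "g x \<in> topspace (ptop X)" "g y \<in> topspace (ptop X)" by auto
    show "(f i (g x), f i (g y)) \<in> pord (D i)" if "i \<in> I" for i
      using fg xy that by (auto simp: pos_mor_def)
  qed
  ultimately show "pos_mor Y X g" by (auto simp: pos_mor_def)
qed

theorem initial_cone_universe:
  assumes "pos_comp X" "\<And>i. i \<in> I \<Longrightarrow> pos_comp (D i)" "initial_cone X I D f"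
  shows "initial_cone_over TYPE('y) X I D f"
proof (rule initial_coneI[OF assms(1,2)])
  show "pos_mor X (D i) (f i)" if "i \<in> I" for i
    using assms(3) that unfolding initial_cone_def initial_cone_over_def by blast
qed (use initial_cone_order[OF assms] in blast)+

lemma pos_comp_unit_op: "pos_comp unit_op"
proof -
  have "closed {p :: real \<times> real. snd p \<le> fst p}"
    by (intro closed_Collect_le continuous_intros)
  then have "closedin (top_of_set ({0..1} \<times> {0..1})) (({0..1} \<times> {0..1}) \<inter> {p :: real \<times> real. snd p \<le> fst p})"
    by (rule closedin_closed_Int)
  moreover have "({0..1} \<times> {0..1}) \<inter> {p :: real \<times> real. snd p \<le> fst p} = pord unit_op"
    by (auto simp: unit_op_def)
  ultimately have "closedin (prod_topology (ptop unit_op) (ptop unit_op)) (pord unit_op)"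
    by (simp add: unit_op_def prod_topology_subtopology_eu)
  then show ?thesis
    unfolding pos_comp_def partial_order_on_def preorder_on_def
    by (auto simp: unit_op_def compact_space_subtopology refl_on_def trans_def antisym_def)
qed

end

theory Submission
  imports Defs
begin

text \<open>An injective morphism \<open>m\<close> is fully faithful. A colimit in \<open>CX\<close> weighted by a right adjoint
  weight is a uniform limit of continuous functions, so \<open>CX\<close> is Cauchy-complete, and so is every
  object isomorphic to it. Conversely, the image of \<open>m\<close> is uniformly dense by a Stone-Weierstrass
  argument in which tensor products replace the missing binary infima: for \<open>y\<close> in \<open>X\<close> it contains
  functions with value \<open>1\<close> at \<open>y\<close> that are small wherever a given function of \<open>CX\<close> is smaller than
  at \<open>y\<close> by a fixed amount. If \<open>A\<close> is Cauchy-complete, the image is moreover closed under limits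
  for the enriched structure. These are the uniform limits for the Lukasiewicz tensor;
  for multiplication they agree with uniform limits only for functions bounded away from \<open>0\<close>, and
  the action \<open>\<ominus>\<close> and the powers reduce the general case to this one. A bijective fully faithful
  morphism is an isomorphism.\<close>

section \<open>The tensors\<close>

lemma tens_zero: "u \<in> {0..1} \<Longrightarrow> tens k 0 u = 0" "u \<in> {0..1} \<Longrightarrow> tens k u 0 = 0"
  by (cases k; auto)+

lemma tens_le_left: "\<lbrakk>u \<in> {0..1}; v \<in> {0..1}\<rbrakk> \<Longrightarrow> tens k u v \<le> u"
  using tens_mono[of u u v 1 k] by (simp add: tens_one)

lemma tens_le_right: "\<lbrakk>u \<in> {0..1}; v \<in> {0..1}\<rbrakk> \<Longrightarrow> tens k u v \<le> v"
  using tens_le_left[of v u k] by (simp add: tens_comm)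

text \<open>Both tensors lie above the Lukasiewicz one, so deviations from \<open>1\<close> at most
  add up; for multiplication this is \<open>(1 - u) * (1 - v) \<ge> 0\<close>.\<close>

lemma tens_lower_bound:
  assumes "u \<in> {0..1}" "v \<in> {0..1}"
  shows "u + v - 1 \<le> tens k u v"
proof -
  have "0 \<le> (1 - u) * (1 - v)" using assms by (intro mult_nonneg_nonneg) auto
  then show ?thesis by (cases k) (auto simp: algebra_simps)
qed

lemma ihom_eq_one_iff:
  assumes "u \<in> {0..1}" "w \<in> {0..1}"
  shows "ihom k u w = 1 \<longleftrightarrow> u \<le> w"
  using ihom_adj[of u 1 w k] ihom_range[OF assms, of k] assms by (auto simp: tens_one)

lemma ihom_mono:
  assumes "u \<in> {0..1}" "w \<in> {0..1}" "w' \<in> {0..1}" "w \<le> w'"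
  shows "ihom k u w \<le> ihom k u w'"
  using ihom_adj[of u "ihom k u w" w k] ihom_adj[of u "ihom k u w" w' k] ihom_range[of u w k] assms
  by auto

lemma continuous_on_tens: "continuous_on S (tens k u)"
proof (cases k)
  case Multiplication
  then have "tens k u = (\<lambda>v. u * v)" by auto
  then show ?thesis by (auto intro!: continuous_intros)
next
  case Lukasiewicz
  then have "tens k u = (\<lambda>v. max 0 (u + v - 1))" by auto
  then show ?thesis by (auto intro!: continuous_intros)
qed

text \<open>The first argument stays fixed: for multiplication, \<open>ihom\<close> as a function of
  both arguments is discontinuous at \<open>(0, 0)\<close>.\<close>

lemma continuous_on_ihom:
  assumes u: "u \<in> {0..1}"
  shows "continuous_on {0..1} (ihom k u)"
proof (cases k)
  case Multiplication
  show ?thesis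
  proof (cases "u = 0")
    case True
    then have "ihom k u w = 1" if "w \<in> {0..1}" for w
      using that ihom_eq_one_iff[of u w k] by auto
    then have "continuous_on {0..1} (ihom k u) \<longleftrightarrow> continuous_on {0..1} (\<lambda>_::real. 1::real)"
      by (intro continuous_on_cong refl)
    then show ?thesis by simp
  next
    case False
    with Multiplication u have "ihom k u w = min 1 (w / u)" if "w \<in> {0..1}" for w
      using that by (auto simp: ihom_Multiplication min_def divide_simps)
    then have "continuous_on {0..1} (ihom k u) \<longleftrightarrow> continuous_on {0..1} (\<lambda>w. min 1 (w / u))"
      by (intro continuous_on_cong refl)
    moreover have "continuous_on {0..1} (\<lambda>w. min 1 (w / u))"
      using False by (intro continuous_intros) auto
    ultimately show ?thesis by simp
  qed
next
  case Lukasiewicz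
  with u have "ihom k u w = min 1 (1 - u + w)" if "w \<in> {0..1}" for w
    using that by (simp add: ihom_Lukasiewicz)
  then have "continuous_on {0..1} (ihom k u) \<longleftrightarrow> continuous_on {0..1} (\<lambda>w. min 1 (1 - u + w))"
    by (intro continuous_on_cong refl)
  moreover have "continuous_on {0..1} (\<lambda>w. min 1 (1 - u + w))" by (intro continuous_intros)
  ultimately show ?thesis by simp
qed

text \<open>For multiplication the nontrivial value is \<open>w / u = 1 - (u - w) / u\<close>, and
  \<open>u \<ge> 1/2\<close> costs the factor \<open>2\<close>.\<close>

lemma ihom_near_one:
  assumes "u \<in> {0..1}" "w \<in> {0..1}" "u - w \<le> e" "0 \<le> e"
    and "k = Multiplication \<Longrightarrow> 1/2 \<le> max u w"
  shows "1 - 2 * e \<le> ihom k u w"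
proof (cases k)
  case Lukasiewicz
  with assms show ?thesis by (auto simp: ihom_Lukasiewicz)
next
  case Multiplication
  show ?thesis
  proof (cases "u \<le> w")
    case False
    with Multiplication assms(5) have u: "1/2 \<le> u" by auto
    have "u * (1 - 2 * e) \<le> w"
      using assms mult_right_mono[OF u \<open>0 \<le> e\<close>] by (simp add: algebra_simps)
    with False u show ?thesis
      using Multiplication assms(1,2) by (simp add: ihom_Multiplication field_simps)
  qed (use assms ihom_eq_one_iff[of u w k] in simp)
qed

text \<open>Multiplicative powers decay geometrically, Lukasiewicz powers decrease linearly until
  they reach \<open>0\<close>.\<close>

lemma tens_iterate_small:
  assumes s: "0 \<le> s" "s < 1" and e: "0 < e"
  shows "\<exists>n. (tens k s ^^ n) 1 < e"
proof (cases k)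
  case Multiplication
  have "(tens k s ^^ n) 1 = s ^ n" for n by (induction n) (auto simp: Multiplication)
  with real_arch_pow_inv[OF e s(2)] show ?thesis by auto
next
  case Lukasiewicz
  have *: "(tens k s ^^ n) 1 = max 0 (1 - n * (1 - s))" for n
    using s by (induction n) (auto simp: Lukasiewicz algebra_simps max_def)
  obtain n :: nat where "1 < n * (1 - s)" using reals_Archimedean3[of "1 - s"] s by auto
  with e show ?thesis by (intro exI[of _ n]) (simp add: *)
qed

text \<open>A number in \<open>[0,1]\<close> is determined by its lower bounds there, so colimit
  formulas can be proved by chains of adjunction equivalences.\<close>

lemma eq_inf01I:
  assumes "S \<subseteq> {0..1}" "\<And>v. v \<in> {0..1} \<Longrightarrow> v \<le> r \<longleftrightarrow> (\<forall>s\<in>S. v \<le> s)" "r \<in> {0..1}"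
  shows "r = inf01 S"
  using assms(2)[of r] assms(2)[of "inf01 S"] inf01_ge_iff[OF assms(1), of r]
    inf01_ge_iff[OF assms(1), of "inf01 S"] inf01_range[OF assms(1)] assms(3) by auto

lemma finite_subcover_nbhds:
  assumes "compact_space T" "\<And>x. x \<in> topspace T \<Longrightarrow> openin T (U x) \<and> x \<in> U x"
  obtains F where "finite F" "F \<subseteq> topspace T" "topspace T \<subseteq> (\<Union>x\<in>F. U x)"
proof -
  have "compactin T (topspace T)" using assms(1) by (simp add: compact_space_def)
  moreover have "\<forall>V \<in> U ` topspace T. openin T V" "topspace T \<subseteq> \<Union> (U ` topspace T)"
    using assms(2) by auto
  ultimately obtain \<F> where "finite \<F>" "\<F> \<subseteq> U ` topspace T" "topspace T \<subseteq> \<Union> \<F>"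
    unfolding compactin_def by metis
  with that show ?thesis by (metis finite_subset_image)
qed

section \<open>Colimits\<close>

text \<open>Distinct objects are unrelated, so any family of objects with any weights is a diagram;
  its colimit is the join of the weighted copowers.\<close>

definition discrete_ucat :: "'z set \<Rightarrow> 'z ucat" where
  "discrete_ucat I = \<lparr>carrier = I, str = (\<lambda>i j. if i = j then 1 else 0)\<rparr>"

lemma carrier_discrete_ucat [simp]: "carrier (discrete_ucat I) = I"
  by (simp add: discrete_ucat_def)

lemma weighted_diagram_discrete:
  assumes X: "ucategory k X" and g: "\<And>i. i \<in> I \<Longrightarrow> g i \<in> carrier X"
    and u: "\<And>i. i \<in> I \<Longrightarrow> u i \<in> {0..1}"
  shows "weighted_diagram k X (discrete_ucat I) g u"
proof -
  have "ucategory k (discrete_ucat I)"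
    by (auto simp: ucategory_def discrete_ucat_def tens_zero tens_one)
  moreover have "ufunctor (discrete_ucat I) X g"
    using X g by (auto simp: ufunctor_def discrete_ucat_def ucategory_def)
  moreover have "weight k (discrete_ucat I) u"
    using u by (auto simp: weight_def discrete_ucat_def tens_zero tens_one)
  ultimately show ?thesis by (simp add: weighted_diagram_def)
qed

lemma is_colimit_unique:
  assumes "ucategory k X" "separated X" "is_colimit k X Z h \<psi> x" "is_colimit k X Z h \<psi> y"
  shows "x = y"
proof -
  have eq: "str X x z = str X y z" if "z \<in> carrier X" for z
    using assms(3,4) that by (simp_all add: is_colimit_def)
  have xy: "x \<in> carrier X" "y \<in> carrier X" using assms(3,4) by (auto simp: is_colimit_def)
  then have "str X x y = 1" "str X y x = 1"
    using eq[OF xy(1)] eq[OF xy(2)] assms(1) by (auto simp: ucategory_def)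
  with xy assms(2) show ?thesis by (auto simp: separated_def nat_le_def)
qed

section \<open>The category of continuous antitone functions\<close>

locale function_algebra =
  fixes k :: tensor and X :: "'x pospace"
  assumes X: "pos_comp X"
begin

abbreviation "T \<equiv> topspace (ptop X)"
abbreviation "C \<equiv> C_alg k X"
abbreviation "I \<equiv> {0..1::real}"

section \<open>Membership in the carrier of \<open>C\<close> and closure under pointwise
  operations\<close>

lemma pord_topspace: "(x, y) \<in> pord X \<Longrightarrow> x \<in> T \<and> y \<in> T"
  using X by (auto simp: pos_comp_def partial_order_on_def preorder_on_def)

lemma C_iff: "f \<in> carrier C \<longleftrightarrow> f \<in> extensional T \<and> f \<in> T \<rightarrow> I \<and>
    continuous_map (ptop X) euclideanreal f \<and> (\<forall>(x, y)\<in>pord X. f y \<le> f x)"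
proof -
  have "(\<forall>(x, y)\<in>pord X. (f x, f y) \<in> pord unit_op) \<longleftrightarrow> (\<forall>(x, y)\<in>pord X. f y \<le> f x)"
    if "f \<in> T \<rightarrow> I"
    using that pord_topspace by (force simp: unit_op_def Pi_iff)
  then show ?thesis
    by (auto simp: C_alg_def pos_mor_def continuous_map_in_subtopology unit_op_def)
qed

lemma C_I:
  assumes "f \<in> extensional T" "\<And>x. x \<in> T \<Longrightarrow> f x \<in> I" "continuous_map (ptop X) euclideanreal f"
    "\<And>x y. \<lbrakk>(x, y) \<in> pord X; x \<in> T; y \<in> T\<rbrakk> \<Longrightarrow> f y \<le> f x"
  shows "f \<in> carrier C"
  using assms pord_topspace by (simp add: C_iff Pi_iff) blast

lemma C_antimono: "f \<in> carrier C \<Longrightarrow> (x, y) \<in> pord X \<Longrightarrow> f y \<le> f x"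
  by (auto simp: C_iff)

lemma C_range: "f \<in> carrier C \<Longrightarrow> x \<in> T \<Longrightarrow> f x \<in> I"
  unfolding C_iff by blast

lemma C_continuous: "f \<in> carrier C \<Longrightarrow> continuous_map (ptop X) euclideanreal f"
  by (simp add: C_iff)

lemma C_eqI:
  assumes "f \<in> carrier C" "g \<in> carrier C" "\<And>x. x \<in> T \<Longrightarrow> f x = g x"
  shows "f = g"
  using assms by (intro extensionalityI[of _ T]) (auto simp: C_iff)

lemma C_compose:
  assumes f: "f \<in> carrier C" and \<phi>: "continuous_on I \<phi>" "mono_on I \<phi>" "\<phi> \<in> I \<rightarrow> I"
  shows "(\<lambda>x\<in>T. \<phi> (f x)) \<in> carrier C"
proof (rule C_I)
  have "continuous_map (ptop X) (top_of_set I) f"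
    using f by (auto simp: C_iff continuous_map_in_subtopology)
  then have "continuous_map (ptop X) euclideanreal (\<phi> \<circ> f)"
    by (rule continuous_map_compose) (use \<phi>(1) in simp)
  then show "continuous_map (ptop X) euclideanreal (\<lambda>x\<in>T. \<phi> (f x))"
    by (rule continuous_map_eq) auto
  show "(\<lambda>x\<in>T. \<phi> (f x)) x \<in> I" if "x \<in> T" for x
    using funcset_mem[OF \<phi>(3) C_range[OF f that]] that by simp
  show "(\<lambda>x\<in>T. \<phi> (f x)) y \<le> (\<lambda>x\<in>T. \<phi> (f x)) x" if "(x, y) \<in> pord X" "x \<in> T" "y \<in> T" for x y
    using mono_onD[OF \<phi>(2) C_range[OF f that(3)] C_range[OF f that(2)] C_antimono[OF f that(1)]] that
    by simp
qed simp

lemma C_const: "u \<in> I \<Longrightarrow> (\<lambda>x\<in>T. u) \<in> carrier C"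
  by (rule C_I) (auto intro: continuous_map_eq[of _ _ "\<lambda>_. u"])

lemma C_max:
  assumes f: "f \<in> carrier C" and g: "g \<in> carrier C"
  shows "(\<lambda>x\<in>T. max (f x) (g x)) \<in> carrier C"
proof (rule C_I)
  have "continuous_map (ptop X) euclideanreal (\<lambda>x. max (f x) (g x))"
    using f g by (intro continuous_map_real_max C_continuous)
  then show "continuous_map (ptop X) euclideanreal (\<lambda>x\<in>T. max (f x) (g x))"
    by (rule continuous_map_eq) auto
  show "(\<lambda>x\<in>T. max (f x) (g x)) x \<in> I" if "x \<in> T" for x
    using C_range[OF f that] C_range[OF g that] that by auto
  show "(\<lambda>x\<in>T. max (f x) (g x)) y \<le> (\<lambda>x\<in>T. max (f x) (g x)) x"
    if "(x, y) \<in> pord X" "x \<in> T" "y \<in> T" for x y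
    using C_antimono[OF f that(1)] C_antimono[OF g that(1)] that by auto
qed simp

lemma C_tens:
  assumes "f \<in> carrier C" "u \<in> I"
  shows "(\<lambda>x\<in>T. tens k u (f x)) \<in> carrier C"
  using assms(2)
  by (intro C_compose[OF assms(1)] continuous_on_tens mono_onI tens_mono funcsetI tens_range) auto

lemma C_ihom:
  assumes "f \<in> carrier C" "u \<in> I"
  shows "(\<lambda>x\<in>T. ihom k u (f x)) \<in> carrier C"
  using assms(2)
  by (intro C_compose[OF assms(1)] continuous_on_ihom mono_onI ihom_mono funcsetI ihom_range) auto

section \<open>The enriched structure of \<open>C\<close>, its colimits and its powers\<close>

lemma str_eq: "str C f g = inf01 ((\<lambda>x. ihom k (f x) (g x)) ` T)"
  by (simp add: C_alg_def)

lemma C_str_range: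
  assumes "f \<in> carrier C" "g \<in> carrier C"
  shows "str C f g \<in> I"
  unfolding str_eq using assms by (intro inf01_range image_subsetI ihom_range C_range)

lemma le_str_iff:
  assumes "f \<in> carrier C" "g \<in> carrier C" "u \<in> I"
  shows "u \<le> str C f g \<longleftrightarrow> (\<forall>x\<in>T. tens k (f x) u \<le> g x)"
proof -
  have "(\<lambda>x. ihom k (f x) (g x)) ` T \<subseteq> I"
    using assms by (intro image_subsetI ihom_range C_range)
  then have "u \<le> str C f g \<longleftrightarrow> (\<forall>x\<in>T. u \<le> ihom k (f x) (g x))"
    unfolding str_eq using assms by (subst inf01_ge_iff) auto
  also have "\<dots> \<longleftrightarrow> (\<forall>x\<in>T. tens k (f x) u \<le> g x)"
    using assms C_range by (intro ball_cong refl ihom_adj[symmetric]) blast+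
  finally show ?thesis .
qed

lemma tens_str_le:
  assumes "f \<in> carrier C" "g \<in> carrier C" "x \<in> T"
  shows "tens k (f x) (str C f g) \<le> g x"
  using le_str_iff[OF assms(1,2) C_str_range[OF assms(1,2)]] assms(3) by blast

lemma str_eq_one_iff:
  assumes "f \<in> carrier C" "g \<in> carrier C"
  shows "str C f g = 1 \<longleftrightarrow> (\<forall>x\<in>T. f x \<le> g x)"
proof -
  have "str C f g = 1 \<longleftrightarrow> 1 \<le> str C f g" using C_str_range[OF assms] by auto
  also have "\<dots> \<longleftrightarrow> (\<forall>x\<in>T. tens k (f x) 1 \<le> g x)" using assms by (intro le_str_iff) auto
  also have "\<dots> \<longleftrightarrow> (\<forall>x\<in>T. f x \<le> g x)"
    using assms by (intro ball_cong refl) (simp only: tens_one C_range)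
  finally show ?thesis .
qed

lemma C_ucategory: "ucategory k C"
  unfolding ucategory_def
proof (intro conjI ballI)
  fix f g h assume fgh: "f \<in> carrier C" "g \<in> carrier C" "h \<in> carrier C"
  note I = C_str_range[OF fgh(1,2)] C_str_range[OF fgh(2,3)]
  show "tens k (str C f g) (str C g h) \<le> str C f h"
  proof (subst le_str_iff[OF fgh(1,3) tens_range[OF I]], intro ballI)
    fix x assume x: "x \<in> T"
    note R = C_range[OF fgh(1) x] C_range[OF fgh(2) x]
    have "tens k (f x) (tens k (str C f g) (str C g h)) = tens k (tens k (f x) (str C f g)) (str C g h)"
      using I R by (intro tens_assoc[symmetric])
    also have "\<dots> \<le> tens k (g x) (str C g h)"
      using I R fgh x by (intro tens_mono tens_range tens_str_le order_refl)
    also have "\<dots> \<le> h x" using fgh x by (intro tens_str_le)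
    finally show "tens k (f x) (tens k (str C f g) (str C g h)) \<le> h x" .
  qed
qed (simp_all add: C_str_range str_eq_one_iff del: atLeastAtMost_iff)

lemma C_separated: "separated C"
  unfolding separated_def nat_le_def
  by (auto simp: str_eq_one_iff intro!: C_eqI intro: order.antisym)

text \<open>Tensoring with \<open>v\<close> preserves suprema, so a lower bound \<open>v\<close> can
  be tested at each point and each index separately; exchanging these two quantifiers gives the
  universal property.\<close>

lemma C_colimit:
  assumes h: "h \<in> carrier Z \<rightarrow> carrier C" and \<psi>: "\<psi> \<in> carrier Z \<rightarrow> I" and s: "s \<in> carrier C"
    and eq: "\<And>x. x \<in> T \<Longrightarrow> s x = sup01 ((\<lambda>z. tens k (\<psi> z) (h z x)) ` carrier Z)"
  shows "is_colimit k C Z h \<psi> s"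
  unfolding is_colimit_def
proof (intro conjI ballI s eq_inf01I)
  fix g assume g: "g \<in> carrier C"
  have hC: "h z \<in> carrier C" and \<psi>I: "\<psi> z \<in> I" if "z \<in> carrier Z" for z
    using h \<psi> that by blast+
  show "(\<lambda>z. ihom k (\<psi> z) (str C (h z) g)) ` carrier Z \<subseteq> I"
    using g by (intro image_subsetI ihom_range C_str_range hC \<psi>I)
  show "str C s g \<in> I" using s g by (rule C_str_range)
  fix v assume v: "v \<in> I"
  have "v \<le> str C s g \<longleftrightarrow> (\<forall>x\<in>T. tens k v (s x) \<le> g x)"
    using le_str_iff[OF s g v] by (simp add: tens_comm)
  also have "\<dots> \<longleftrightarrow> (\<forall>x\<in>T. \<forall>z\<in>carrier Z. tens k v (tens k (\<psi> z) (h z x)) \<le> g x)"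
  proof (intro ball_cong refl)
    fix x assume x: "x \<in> T"
    have "(\<lambda>z. tens k (\<psi> z) (h z x)) ` carrier Z \<subseteq> I"
      using x by (intro image_subsetI tens_range C_range hC \<psi>I)
    from tens_sup01_le_iff[OF this v C_range[OF g x]]
    show "tens k v (s x) \<le> g x \<longleftrightarrow> (\<forall>z\<in>carrier Z. tens k v (tens k (\<psi> z) (h z x)) \<le> g x)"
      by (simp add: eq[OF x])
  qed
  also have "\<dots> \<longleftrightarrow> (\<forall>z\<in>carrier Z. \<forall>x\<in>T. tens k (h z x) (tens k (\<psi> z) v) \<le> g x)"
  proof -
    have "tens k v (tens k (\<psi> z) (h z x)) = tens k (h z x) (tens k (\<psi> z) v)"
      if "x \<in> T" "z \<in> carrier Z" for x z
      using tens_assoc[OF v \<psi>I[OF that(2)] C_range[OF hC[OF that(2)] that(1)], of k]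
      by (simp add: tens_comm)
    then show ?thesis by auto
  qed
  also have "\<dots> \<longleftrightarrow> (\<forall>z\<in>carrier Z. tens k (\<psi> z) v \<le> str C (h z) g)"
    using g v by (intro ball_cong refl le_str_iff[symmetric] hC tens_range \<psi>I)
  also have "\<dots> \<longleftrightarrow> (\<forall>z\<in>carrier Z. v \<le> ihom k (\<psi> z) (str C (h z) g))"
    using g v by (intro ball_cong refl ihom_adj hC \<psi>I C_str_range)
  finally show "v \<le> str C s g \<longleftrightarrow> (\<forall>r\<in>(\<lambda>z. ihom k (\<psi> z) (str C (h z) g)) ` carrier Z. v \<le> r)"
    by auto
qed

lemma C_finite_sup:
  assumes "finite J" and g: "\<And>j. j \<in> J \<Longrightarrow> g j \<in> carrier C" and u: "\<And>j. j \<in> J \<Longrightarrow> u j \<in> I"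
  shows "(\<lambda>x\<in>T. sup01 ((\<lambda>j. tens k (u j) (g j x)) ` J)) \<in> carrier C"
  using assms
proof (induction J)
  case empty
  have "(\<lambda>x\<in>T. sup01 ((\<lambda>j. tens k (u j) (g j x)) ` {})) = (\<lambda>x\<in>T. 0)"
    by (simp add: sup01_def)
  then show ?case using C_const[of 0] by (simp only: atLeastAtMost_iff order_refl zero_le_one)
next
  case (insert i J)
  let ?s = "\<lambda>x. sup01 ((\<lambda>j. tens k (u j) (g j x)) ` J)"
  have eq: "sup01 ((\<lambda>j. tens k (u j) (g j x)) ` insert i J) = max (tens k (u i) (g i x)) (?s x)" for x
    \<comment> \<open>\<open>sup01\<close> inserts \<open>0\<close>; moving it past the new value
      keeps the remaining set nonempty, so that \<open>Max\<close> splits off that value even when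
      \<open>J\<close> is empty.\<close>
    unfolding sup01_def image_insert using insert.hyps(1)
    by (subst insert_commute) (simp add: cSup_eq_Max)
  have "(\<lambda>x\<in>T. max ((\<lambda>x\<in>T. tens k (u i) (g i x)) x) ((\<lambda>x\<in>T. ?s x) x)) \<in> carrier C"
    using insert by (intro C_max C_tens) auto
  moreover have "(\<lambda>x\<in>T. sup01 ((\<lambda>j. tens k (u j) (g j x)) ` insert i J)) =
      (\<lambda>x\<in>T. max ((\<lambda>x\<in>T. tens k (u i) (g i x)) x) ((\<lambda>x\<in>T. ?s x) x))"
    by (rule restrict_ext) (simp only: eq restrict_apply')
  ultimately show ?case by (simp only:)
qed

text \<open>Both \<open>p\<close> and the pointwise power lie in \<open>C\<close> and have the same
  elements of \<open>C\<close> below them, hence they agree.\<close>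

lemma C_power:
  assumes f: "f \<in> carrier C" and u: "u \<in> I" and p: "is_power k C f u p" and x: "x \<in> T"
  shows "p x = ihom k u (f x)"
proof -
  have pe: "str C y p = ihom k u (str C y f)" if "y \<in> carrier C" for y
    using p that by (auto simp: is_power_def)
  have pC: "p \<in> carrier C" using p by (auto simp: is_power_def)
  have iff: "(\<forall>x\<in>T. y x \<le> p x) \<longleftrightarrow> (\<forall>x\<in>T. y x \<le> ihom k u (f x))" if y: "y \<in> carrier C" for y
  proof -
    have "(\<forall>x\<in>T. y x \<le> p x) \<longleftrightarrow> u \<le> str C y f"
      using str_eq_one_iff[OF y pC] pe[OF y] ihom_eq_one_iff[OF u C_str_range[OF y f], of k] by simp
    also have "\<dots> \<longleftrightarrow> (\<forall>x\<in>T. tens k u (y x) \<le> f x)"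
      using le_str_iff[OF y f u] by (simp add: tens_comm)
    also have "\<dots> \<longleftrightarrow> (\<forall>x\<in>T. y x \<le> ihom k u (f x))"
      using y f u C_range by (intro ball_cong refl ihom_adj) blast+
    finally show ?thesis .
  qed
  from iff[OF pC] iff[OF C_ihom[OF f u]] x show ?thesis by (auto intro!: order.antisym)
qed

text \<open>If \<open>\<phi>\<close> is left adjoint to the weight \<open>\<psi>\<close>, the pointwise colimit \<open>s\<close> satisfies
  \<open>s \<otimes> \<phi>(z) \<otimes> \<psi>(z) \<le> h(z) \<otimes> \<psi>(z) \<le> s\<close>; since \<open>\<phi>(z) \<otimes> \<psi>(z)\<close> comes arbitrarily close to \<open>1\<close>,
  it is a uniform limit of continuous functions.\<close>

lemma C_right_adjoint_sup:
  assumes h: "ufunctor Z C h" and r: "right_adjoint_weight k Z \<psi>"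
  shows "(\<lambda>x\<in>T. sup01 ((\<lambda>z. tens k (\<psi> z) (h z x)) ` carrier Z)) \<in> carrier C" (is "?s \<in> _")
proof -
  from r obtain \<phi> where \<psi>: "weight k Z \<psi>" and \<phi>: "coweight k Z \<phi>"
    and sup: "sup01 ((\<lambda>z. tens k (\<phi> z) (\<psi> z)) ` carrier Z) = 1"
    and le: "\<And>z z'. z \<in> carrier Z \<Longrightarrow> z' \<in> carrier Z \<Longrightarrow> tens k (\<psi> z) (\<phi> z') \<le> str Z z z'"
    unfolding right_adjoint_weight_def by blast
  have hC: "h z \<in> carrier C" if "z \<in> carrier Z" for z
    using h that by (auto simp: ufunctor_def)
  have \<psi>I: "\<psi> z \<in> I" and \<phi>I: "\<phi> z \<in> I" if "z \<in> carrier Z" for z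
    using \<psi> \<phi> that unfolding weight_def coweight_def by blast+
  have S: "(\<lambda>z. tens k (\<psi> z) (h z x)) ` carrier Z \<subseteq> I" if "x \<in> T" for x
    using that by (intro image_subsetI tens_range \<psi>I C_range hC)
  have sI: "?s x \<in> I" if "x \<in> T" for x
    using sup01_range[OF S[OF that]] that by simp
  have approx: "\<exists>z\<in>carrier Z. \<forall>x\<in>T. \<bar>tens k (\<psi> z) (h z x) - ?s x\<bar> < e" if e: "0 < e" for e
  proof -
    have "\<exists>z\<in>carrier Z. 1 - e < tens k (\<phi> z) (\<psi> z)"
    proof (rule ccontr)
      assume "\<not> ?thesis"
      \<comment> \<open>Truncation makes the bound admissible for \<open>sup01\<close>, which is at
        least \<open>0\<close>, and leaves it below \<open>1\<close>.\<close>
      then have "\<forall>s\<in>(\<lambda>z. tens k (\<phi> z) (\<psi> z)) ` carrier Z. s \<le> max 0 (1 - e)" by force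
      moreover have "(\<lambda>z. tens k (\<phi> z) (\<psi> z)) ` carrier Z \<subseteq> I"
        by (intro image_subsetI tens_range \<psi>I \<phi>I)
      ultimately have "sup01 ((\<lambda>z. tens k (\<phi> z) (\<psi> z)) ` carrier Z) \<le> max 0 (1 - e)"
        by (subst sup01_le_iff) auto
      with sup e show False by auto
    qed
    then obtain z where z: "z \<in> carrier Z" and zw: "1 - e < tens k (\<phi> z) (\<psi> z)" by blast
    have "\<bar>tens k (\<psi> z) (h z x) - ?s x\<bar> < e" if x: "x \<in> T" for x
    proof -
      note R = \<psi>I[OF z] \<phi>I[OF z] C_range[OF hC[OF z] x] sI[OF x]
      have u: "tens k (\<psi> z) (h z x) \<le> ?s x"
        using sup01_upper[OF S[OF x]] z x by auto
      \<comment> \<open>Tensoring with \<open>\<phi> z\<close> commutes with the supremum. For each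
        index \<open>z'\<close>, the adjunction and functoriality of \<open>h\<close> bound
        \<open>tens k (\<psi> z') (\<phi> z)\<close> by the hom from \<open>h z'\<close> to
        \<open>h z\<close>, which is evaluated at \<open>x\<close>.\<close>
      have "tens k (\<phi> z) (?s x) \<le> h z x"
      proof -
        have "tens k (\<phi> z) (tens k (\<psi> z') (h z' x)) \<le> h z x" if z': "z' \<in> carrier Z" for z'
        proof -
          note R' = \<psi>I[OF z'] C_range[OF hC[OF z'] x]
          have "tens k (\<psi> z') (\<phi> z) \<le> str C (h z') (h z)"
            using le[OF z' z] h z z' by (force simp: ufunctor_def)
          then have "tens k (h z' x) (tens k (\<psi> z') (\<phi> z)) \<le> h z x"
            using le_str_iff[OF hC[OF z'] hC[OF z] tens_range[OF R'(1) R(2)], of k] x by blast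
          then show ?thesis using tens_assoc[OF R(2) R', of k] by (simp add: tens_comm)
        qed
        then show ?thesis
          using tens_sup01_le_iff[OF S[OF x] R(2,3), of k] x by simp
      qed
      then have "tens k (\<psi> z) (tens k (\<phi> z) (?s x)) \<le> tens k (\<psi> z) (h z x)"
        using R by (intro tens_mono tens_range order_refl)
      then have "tens k (tens k (\<phi> z) (\<psi> z)) (?s x) \<le> tens k (\<psi> z) (h z x)"
        using tens_assoc[OF R(1,2,4), of k] by (simp add: tens_comm)
      moreover have "tens k (\<phi> z) (\<psi> z) + ?s x - 1 \<le> tens k (tens k (\<phi> z) (\<psi> z)) (?s x)"
        using R by (intro tens_lower_bound tens_range)
      ultimately show ?thesis using u zw by linarith
    qed
    with z show ?thesis by blast
  qed
  have "continuous_map (ptop X) euclideanreal ?s"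
  proof -
    have "\<exists>z. z \<in> carrier Z \<and> (\<forall>x\<in>T. \<bar>tens k (\<psi> z) (h z x) - ?s x\<bar> < inverse (Suc n))" for n
      using approx[of "inverse (Suc n)"] by auto
    then obtain \<zeta> where \<zeta>: "\<And>n. \<zeta> n \<in> carrier Z"
      and near: "\<And>n x. x \<in> T \<Longrightarrow> \<bar>tens k (\<psi> (\<zeta> n)) (h (\<zeta> n) x) - ?s x\<bar> < inverse (Suc n)"
      by metis
    have "continuous_map (ptop X) Met_TC.mtopology ?s"
    proof (rule Met_TC.continuous_map_uniform_limit)
      show "\<forall>\<^sub>F n in sequentially. continuous_map (ptop X) Met_TC.mtopology
          (\<lambda>x\<in>T. tens k (\<psi> (\<zeta> n)) (h (\<zeta> n) x))"
        using C_tens[OF hC[OF \<zeta>] \<psi>I[OF \<zeta>]] by (simp add: C_iff)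
      show "\<forall>\<^sub>F n in sequentially. \<forall>x\<in>T. ?s x \<in> UNIV \<and>
          dist ((\<lambda>x\<in>T. tens k (\<psi> (\<zeta> n)) (h (\<zeta> n) x)) x) (?s x) < e" if e: "0 < e" for e
      proof -
        have "\<forall>\<^sub>F n in sequentially. inverse (real (Suc n)) < e"
          by (rule order_tendstoD(2)[OF LIMSEQ_inverse_real_of_nat e])
        then show ?thesis
        proof eventually_elim
          case (elim n)
          then show ?case using near[of _ n] by (fastforce simp: dist_real_def)
        qed
      qed
    qed simp
    then show ?thesis by simp
  qed
  moreover have "?s y \<le> ?s x" if xy: "(x, y) \<in> pord X" for x y
  proof -
    have T: "x \<in> T" "y \<in> T" using pord_topspace[OF xy] by auto
    have "sup01 ((\<lambda>z. tens k (\<psi> z) (h z y)) ` carrier Z) \<le> ?s x"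
    proof (subst sup01_le_iff[OF S[OF T(2)]])
      show "0 \<le> ?s x" using sI[OF T(1)] by auto
      show "\<forall>s\<in>(\<lambda>z. tens k (\<psi> z) (h z y)) ` carrier Z. s \<le> ?s x"
      proof safe
        fix z assume z: "z \<in> carrier Z"
        have "h z y \<le> h z x" by (rule C_antimono[OF hC[OF z] xy])
        then have "tens k (\<psi> z) (h z y) \<le> tens k (\<psi> z) (h z x)"
          using T by (intro tens_mono \<psi>I z C_range hC order_refl)
        also have "\<dots> \<le> ?s x" using sup01_upper[OF S[OF T(1)]] z T by auto
        finally show "tens k (\<psi> z) (h z y) \<le> ?s x" .
      qed
    qed
    with T show ?thesis by simp
  qed
  ultimately show ?thesis using sI by (intro C_I) (simp_all only: restrict_extensional)
qed

end

section \<open>Separating subalgebras\<close>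

locale embedded_algebra = function_algebra k X for k and X :: "'x pospace" +
  fixes A :: "'a ualg" and m :: "'a \<Rightarrow> 'x \<Rightarrow> real"
  assumes A: "A_obj k A" and m: "A_mor k A (C_alg k X) m" and inj: "inj_on m (carrier A)"
    and ini: "initial_cone X (carrier A) (\<lambda>_. unit_op) m"
begin

section \<open>Full faithfulness of \<open>m\<close> and the operations on its image\<close>

lemma A_Mon: "Mon_obj k A"
  using A by (cases k) (auto simp: A_obj_def Mon_ominus_obj_def)

lemma m_Mon: "Mon_mor k A C m"
  using m by (cases k) (auto simp: A_mor_def Mon_ominus_mor_def)

lemma A_ucategory: "ucategory k A" and A_cocomplete: "finitely_cocomplete k A"
  using A_Mon by (auto simp: Mon_obj_def FinSup_obj_def)

lemma m_ufunctor: "ufunctor A C m" and m_cocontinuous: "finitely_cocontinuous k A C m"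
  using m_Mon by (auto simp: Mon_mor_def FinSup_mor_def)

lemma m_C: "a \<in> carrier A \<Longrightarrow> m a \<in> carrier C"
  using m_ufunctor by (auto simp: ufunctor_def)

lemma A_str_range: "a \<in> carrier A \<Longrightarrow> b \<in> carrier A \<Longrightarrow> str A a b \<in> I"
  using A_ucategory unfolding ucategory_def by blast

text \<open>\<open>m\<close> sends the colimit in \<open>A\<close> to a colimit in \<open>C\<close>,
  where the pointwise supremum is the only one. The index type is left open to allow booleans and
  points of \<open>X\<close>.\<close>

lemma finite_colimit:
  fixes J :: "'z set"
  assumes "finite J" and g: "\<And>j. j \<in> J \<Longrightarrow> g j \<in> carrier A" and u: "\<And>j. j \<in> J \<Longrightarrow> u j \<in> I"
  obtains c where "is_colimit k A (discrete_ucat J) g u c" "c \<in> carrier A"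
    "\<And>x. x \<in> T \<Longrightarrow> m c x = sup01 ((\<lambda>j. tens k (u j) (m (g j) x)) ` J)"
proof -
  let ?Z = "discrete_ucat J" and ?s = "\<lambda>x\<in>T. sup01 ((\<lambda>j. tens k (u j) (m (g j) x)) ` J)"
  have d: "weighted_diagram k A ?Z g u" by (intro weighted_diagram_discrete A_ucategory g u)
  then obtain c where c: "is_colimit k A ?Z g u c"
    using finitely_cocomplete_universe[OF A_cocomplete, where 'z = 'z] assms(1)
    unfolding finitely_cocomplete_over_def by (metis carrier_discrete_ucat)
  then have "is_colimit k C ?Z (m \<circ> g) u (m c)"
    using finitely_cocontinuous_universe[OF m_cocontinuous, where 'z = 'z] assms(1) d
    unfolding finitely_cocontinuous_over_def by (metis carrier_discrete_ucat)
  moreover have "is_colimit k C ?Z (m \<circ> g) u ?s"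
  proof (rule C_colimit)
    show "?s \<in> carrier C" using assms by (intro C_finite_sup m_C)
  qed (use g u m_C in auto)
  ultimately have "m c = ?s" by (rule is_colimit_unique[OF C_ucategory C_separated])
  then have "m c x = sup01 ((\<lambda>j. tens k (u j) (m (g j) x)) ` J)" if "x \<in> T" for x
    using that by simp
  with c show ?thesis by (intro that) (auto simp: is_colimit_def)
qed

text \<open>With \<open>v = str C (m a) (m b)\<close>, injectivity forces \<open>(a \<otimes> v) \<or> b = b\<close>, hence \<open>v \<le> str A a b\<close>.\<close>

lemma str_m:
  assumes a: "a \<in> carrier A" and b: "b \<in> carrier A"
  shows "str C (m a) (m b) = str A a b"
proof (rule order.antisym)
  let ?v = "str C (m a) (m b)"
  \<comment> \<open>The colimit is the join of \<open>b\<close> (index \<open>True\<close>) and the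
    copower of \<open>a\<close> by \<open>?v\<close> (index \<open>False\<close>).\<close>
  let ?g = "\<lambda>i. if i then b else a" and ?u = "\<lambda>i. if i then 1 else ?v"
  have v: "?v \<in> I" using a b by (intro C_str_range m_C)
  obtain c where c: "is_colimit k A (discrete_ucat UNIV) ?g ?u c" "c \<in> carrier A"
    and mc: "\<And>x. x \<in> T \<Longrightarrow> m c x = sup01 ((\<lambda>i. tens k (?u i) (m (?g i) x)) ` UNIV)"
    by (rule finite_colimit[of "UNIV :: bool set" ?g ?u]) (use a b v in auto)
  have "m c = m b"
  proof (rule C_eqI)
    fix x assume x: "x \<in> T"
    note R = C_range[OF m_C[OF a] x] C_range[OF m_C[OF b] x]
    let ?S = "(\<lambda>i. tens k (?u i) (m (?g i) x)) ` UNIV"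
    have S: "?S = {m b x, tens k ?v (m a x)}"
      using tens_one(1)[OF R(2), of k] by (auto simp: UNIV_bool)
    have "tens k ?v (m a x) \<le> m b x"
      using tens_str_le[OF m_C[OF a] m_C[OF b] x] by (simp add: tens_comm)
    moreover have SI: "?S \<subseteq> I" unfolding S using R v tens_range[OF v R(1), of k] by auto
    ultimately have "sup01 ?S \<le> m b x" by (subst sup01_le_iff) (use R S in auto)
    moreover have "m b x \<le> sup01 ?S" by (rule sup01_upper[OF SI]) (simp add: S)
    ultimately show "m c x = m b x" using mc[OF x] by simp
  qed (use b c(2) m_C in auto)
  then have "c = b" using inj b c(2) by (auto dest: inj_onD)
  then have "str A b b = inf01 ((\<lambda>i. ihom k (?u i) (str A (?g i) b)) ` UNIV)"
    using c(1) b by (simp add: is_colimit_def)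
  moreover have "str A b b = 1" using A_ucategory b by (simp add: ucategory_def)
  moreover have "(\<lambda>i. ihom k (?u i) (str A (?g i) b)) ` UNIV \<subseteq> I"
  proof (intro image_subsetI ihom_range)
    fix i :: bool
    show "?u i \<in> I" using v by simp
    show "str A (?g i) b \<in> I" using A_str_range a b by simp
  qed
  ultimately have "\<forall>s\<in>(\<lambda>i. ihom k (?u i) (str A (?g i) b)) ` UNIV. 1 \<le> s"
    by (subst inf01_ge_iff[symmetric]) simp_all
  \<comment> \<open>The infimum equals \<open>str A b b = 1\<close>, so its member at
    \<open>False\<close> is \<open>1\<close>, which compares \<open>?v\<close> with
    \<open>str A a b\<close>.\<close>
  from bspec[OF this rangeI[of _ False]] have "1 \<le> ihom k ?v (str A a b)" by simp
  then show "?v \<le> str A a b"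
    using ihom_eq_one_iff[OF v A_str_range[OF a b], of k] ihom_range[OF v A_str_range[OF a b], of k]
    by auto
qed (use m_ufunctor a b in \<open>simp add: ufunctor_def\<close>)

text \<open>Powers in \<open>A\<close> are given only by a universal property; preservation by
  \<open>m\<close> makes them pointwise.\<close>

lemma power_exists:
  assumes a: "a \<in> carrier A" and u: "u \<in> I"
  obtains p where "p \<in> carrier A" "\<And>x. x \<in> T \<Longrightarrow> m p x = ihom k u (m a x)"
proof -
  obtain p where p: "is_power k A a u p"
    using A a u unfolding A_obj_def powered_def by blast
  then have "is_power k C (m a) u (m p)"
    using m a u by (auto simp: A_mor_def preserves_powers_def)
  from C_power[OF m_C[OF a] u this] p that show ?thesis by (auto simp: is_power_def)
qed

lemma m_mult:
  assumes "a \<in> carrier A" "b \<in> carrier A" "x \<in> T"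
  shows "mult A a b \<in> carrier A" "m (mult A a b) x = tens k (m a x) (m b x)"
  using assms A_Mon m_Mon by (auto simp: Mon_obj_def Mon_mor_def C_alg_def)

lemma m_one: "one A \<in> carrier A" "x \<in> T \<Longrightarrow> m (one A) x = 1"
  using A_Mon m_Mon by (auto simp: Mon_obj_def Mon_mor_def C_alg_def)

section \<open>Uniform density of the image\<close>

lemma C_order_separation:
  assumes f: "f \<in> carrier C" and xy: "x \<in> T" "y \<in> T" "f x < f y"
  obtains a where "a \<in> carrier A" "m a x < m a y"
proof -
  \<comment> \<open>\<open>f\<close> is antitone, so \<open>f x < f y\<close> excludes
    \<open>x\<close> below \<open>y\<close>. By initiality some \<open>m a\<close> detects this, and
    the dual order of \<open>unit_op\<close> turns it into \<open>m a x < m a y\<close>.\<close>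
  have "(x, y) \<notin> pord X" using f xy(3) by (auto simp: C_iff)
  then obtain a where a: "a \<in> carrier A" "(m a x, m a y) \<notin> pord unit_op"
    using initial_cone_order[OF X pos_comp_unit_op ini xy(1,2)] by blast
  then have "m a x < m a y"
    using C_range[OF m_C[OF a(1)]] xy by (auto simp: unit_op_def)
  with a that show ?thesis by blast
qed

text \<open>The power \<open>a \<pitchfork> m a y\<close> takes the value \<open>1\<close> at \<open>y\<close> and a value below \<open>1\<close> at \<open>x\<close>, which its
  tensor powers make arbitrarily small.\<close>

lemma peak_exists:
  assumes f: "f \<in> carrier C" and xy: "x \<in> T" "y \<in> T" "f x < f y" and e: "0 < e"
  obtains a where "a \<in> carrier A" "m a y = 1" "m a x < e"
proof -
  obtain b where b: "b \<in> carrier A" "m b x < m b y" by (rule C_order_separation[OF f xy]) blast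
  note R = C_range[OF m_C[OF b(1)] xy(1)] C_range[OF m_C[OF b(1)] xy(2)]
  obtain p where p: "p \<in> carrier A" "\<And>z. z \<in> T \<Longrightarrow> m p z = ihom k (m b y) (m b z)"
    by (rule power_exists[OF b(1) R(2)]) blast
  have py: "m p y = 1" using p(2)[OF xy(2)] ihom_eq_one_iff[OF R(2) R(2), of k] by simp
  have "m p x \<noteq> 1" using p(2)[OF xy(1)] ihom_eq_one_iff[OF R(2) R(1), of k] b(2) by simp
  then have px: "0 \<le> m p x" "m p x < 1" using C_range[OF m_C[OF p(1)] xy(1)] by auto
  \<comment> \<open>The iterates are the tensor powers of \<open>p\<close>; starting from
    \<open>one A\<close>, the case \<open>n = 0\<close> is the constant \<open>1\<close>.\<close>
  have "(mult A p ^^ n) (one A) \<in> carrier A \<and>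
      (\<forall>z\<in>T. m ((mult A p ^^ n) (one A)) z = (tens k (m p z) ^^ n) 1)" for n
  proof (induction n)
    case (Suc n)
    moreover have "mult A p c \<in> carrier A" if "c \<in> carrier A" for c
      using p(1) that A_Mon by (auto simp: Mon_obj_def)
    ultimately show ?case using m_mult(2)[OF p(1)] by simp
  qed (simp add: m_one)
  moreover have "(tens k 1 ^^ n) 1 = 1" for n
    by (induction n) (simp_all add: tens_one)
  moreover obtain n where "(tens k (m p x) ^^ n) 1 < e"
    using tens_iterate_small[OF px e] by blast
  ultimately show ?thesis using xy py that[of "(mult A p ^^ n) (one A)"] by simp
qed

text \<open>The algebra has no binary infima; the tensor product of functions with value \<open>1\<close> at \<open>y\<close>
  takes their place.\<close>

lemma finite_product_exists:
  assumes "finite J" "y \<in> T" "\<And>j. j \<in> J \<Longrightarrow> g j \<in> carrier A" "\<And>j. j \<in> J \<Longrightarrow> m (g j) y = 1"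
  shows "\<exists>a\<in>carrier A. m a y = 1 \<and> (\<forall>x\<in>T. \<forall>j\<in>J. m a x \<le> m (g j) x)"
  using assms
proof (induction J)
  case empty
  show ?case by (intro bexI[of _ "one A"]) (simp_all add: m_one empty)
next
  case (insert i J)
  then obtain a where a: "a \<in> carrier A" "m a y = 1" "\<And>x j. x \<in> T \<Longrightarrow> j \<in> J \<Longrightarrow> m a x \<le> m (g j) x"
    by auto
  have i: "g i \<in> carrier A" "m (g i) y = 1" using insert.prems by auto
  let ?b = "mult A (g i) a"
  have "m ?b x \<le> m (g j) x" if x: "x \<in> T" and j: "j \<in> insert i J" for x j
  proof -
    note R = C_range[OF m_C[OF i(1)] x] C_range[OF m_C[OF a(1)] x]
    show ?thesis
      using m_mult(2)[OF i(1) a(1) x] tens_le_left[OF R, of k] tens_le_right[OF R, of k] a(3)[OF x] j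
      by force
  qed
  moreover have "m ?b y = 1" using m_mult(2)[OF i(1) a(1) insert.prems(1)] i a by (simp add: tens_one)
  moreover have "?b \<in> carrier A" using m_mult(1)[OF i(1) a(1) insert.prems(1)] .
  ultimately show ?case by blast
qed

text \<open>This is compactness in \<open>x\<close> for a fixed \<open>y\<close>: near each
  \<open>x\<close> one function with value \<open>1\<close> at \<open>y\<close> suffices, and a
  product of finitely many lies below each of them.\<close>

lemma local_approximation:
  assumes f: "f \<in> carrier C" and y: "y \<in> T" and e: "0 < e"
  obtains a where "a \<in> carrier A" "m a y = 1" "\<And>x. x \<in> T \<Longrightarrow> tens k (f y) (m a x) \<le> f x + e"
proof -
  have "\<exists>a U. a \<in> carrier A \<and> m a y = 1 \<and> openin (ptop X) U \<and> x \<in> U \<and>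
      (\<forall>z\<in>U. tens k (f y) (m a z) \<le> f z + e)" if x: "x \<in> T" for x
  proof (cases "f y < f x + e")
    case True
    \<comment> \<open>Where \<open>f\<close> exceeds \<open>f y - e\<close>, the unit of
      \<open>A\<close> already satisfies the bound.\<close>
    let ?U = "{z \<in> T. f z \<in> {f y - e<..}}"
    have "openin (ptop X) ?U"
      using C_continuous[OF f] by (rule openin_continuous_map_preimage) simp
    moreover have "tens k (f y) (m (one A) z) \<le> f z + e" if "z \<in> ?U" for z
      using that m_one C_range[OF f y] by (simp add: tens_one)
    ultimately show ?thesis using True x y by (intro exI[of _ "one A"] exI[of _ ?U]) (auto simp: m_one)
  next
    case False
    with e have "f x < f y" by simp
    then obtain a where a: "a \<in> carrier A" "m a y = 1" "m a x < e"
      by (rule peak_exists[OF f x y _ e]) blast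
    \<comment> \<open>The peak stays below \<open>e\<close> near \<open>x\<close>; tensoring with
      \<open>f y\<close> only lowers it, and \<open>f\<close> is nonnegative.\<close>
    let ?U = "{z \<in> T. m a z \<in> {..<e}}"
    have "openin (ptop X) ?U"
      using C_continuous[OF m_C[OF a(1)]] by (rule openin_continuous_map_preimage) simp
    moreover have "tens k (f y) (m a z) \<le> f z + e" if "z \<in> ?U" for z
      using that tens_le_right[OF C_range[OF f y] C_range[OF m_C[OF a(1)]], of z k] C_range[OF f, of z]
      by auto
    ultimately show ?thesis using a x by (intro exI[of _ a] exI[of _ ?U]) auto
  qed
  then obtain g U where gU: "\<And>x. x \<in> T \<Longrightarrow> g x \<in> carrier A \<and> m (g x) y = 1 \<and>
      openin (ptop X) (U x) \<and> x \<in> U x \<and> (\<forall>z\<in>U x. tens k (f y) (m (g x) z) \<le> f z + e)"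
    by metis
  obtain F where F: "finite F" "F \<subseteq> T" "T \<subseteq> (\<Union>x\<in>F. U x)"
    by (rule finite_subcover_nbhds[of "ptop X" U]) (use X gU in \<open>auto simp: pos_comp_def\<close>)
  have "\<exists>a\<in>carrier A. m a y = 1 \<and> (\<forall>x\<in>T. \<forall>j\<in>F. m a x \<le> m (g j) x)"
    using F(1) y by (rule finite_product_exists) (use F(2) gU in auto)
  then obtain a where a: "a \<in> carrier A" "m a y = 1" "\<forall>x\<in>T. \<forall>j\<in>F. m a x \<le> m (g j) x"
    by blast
  have "tens k (f y) (m a x) \<le> f x + e" if x: "x \<in> T" for x
  proof -
    obtain j where j: "j \<in> F" "x \<in> U j" using F(3) x by blast
    then have jT: "j \<in> T" using F(2) by blast
    have "tens k (f y) (m a x) \<le> tens k (f y) (m (g j) x)"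
      using a j x gU[OF jT] y f by (intro tens_mono C_range m_C) auto
    also have "\<dots> \<le> f x + e" using gU[OF jT] j by blast
    finally show ?thesis .
  qed
  with a that show ?thesis by blast
qed

text \<open>This is compactness in \<open>y\<close>: the copower by \<open>f y\<close> of a local
  approximation at \<open>y\<close> agrees with \<open>f\<close> at \<open>y\<close>, stays below
  \<open>f + e\<close> and exceeds \<open>f - e\<close> near \<open>y\<close>. A finite join of such
  copowers is within \<open>e\<close> everywhere.\<close>

lemma uniformly_dense:
  assumes f: "f \<in> carrier C" and e: "0 < e"
  obtains a where "a \<in> carrier A" "\<And>x. x \<in> T \<Longrightarrow> \<bar>m a x - f x\<bar> \<le> e"
proof -
  have "\<exists>a. a \<in> carrier A \<and> m a y = 1 \<and> (\<forall>x\<in>T. tens k (f y) (m a x) \<le> f x + e)" if "y \<in> T" for y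
    by (rule local_approximation[OF f that e]) blast
  then obtain g where g: "\<And>y. y \<in> T \<Longrightarrow> g y \<in> carrier A" "\<And>y. y \<in> T \<Longrightarrow> m (g y) y = 1"
    "\<And>x y. x \<in> T \<Longrightarrow> y \<in> T \<Longrightarrow> tens k (f y) (m (g y) x) \<le> f x + e"
    by metis
  define t where "t y x = tens k (f y) (m (g y) x)" for y x
  have tC: "(\<lambda>x\<in>T. t y x) \<in> carrier C" if "y \<in> T" for y
    unfolding t_def using that f g(1) by (intro C_tens m_C C_range)
  define U where "U y = {x \<in> T. (\<lambda>x\<in>T. t y x) x - f x \<in> {- e<..}}" for y
  have "openin (ptop X) (U y) \<and> y \<in> U y" if y: "y \<in> T" for y
  proof
    show "openin (ptop X) (U y)" unfolding U_def
      by (rule openin_continuous_map_preimage[where Y = euclideanreal])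
        (intro continuous_map_diff C_continuous tC[OF y] f, simp)
    show "y \<in> U y" using y e g(2)[OF y] C_range[OF f y] by (simp add: U_def t_def tens_one)
  qed
  then obtain F where F: "finite F" "F \<subseteq> T" "T \<subseteq> (\<Union>y\<in>F. U y)"
    using finite_subcover_nbhds[of "ptop X" U] X by (auto simp: pos_comp_def)
  obtain c where c: "c \<in> carrier A" "\<And>x. x \<in> T \<Longrightarrow> m c x = sup01 ((\<lambda>y. t y x) ` F)"
    unfolding t_def by (rule finite_colimit[of F g f]) (use F f g C_range in blast)+
  have "\<bar>m c x - f x\<bar> \<le> e" if x: "x \<in> T" for x
  proof -
    have S: "(\<lambda>y. t y x) ` F \<subseteq> I"
      using F(2) x f g(1) unfolding t_def by (intro image_subsetI tens_range C_range m_C) auto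
    have "sup01 ((\<lambda>y. t y x) ` F) \<le> f x + e"
      by (subst sup01_le_iff[OF S]) (use C_range[OF f x] e g(3) F(2) x in \<open>auto simp: t_def\<close>)
    moreover obtain y where y: "y \<in> F" "x \<in> U y" using F(3) x by blast
    then have "f x - e < t y x" using x by (auto simp: U_def)
    moreover have "t y x \<le> sup01 ((\<lambda>y. t y x) ` F)" by (rule sup01_upper[OF S]) (use y in auto)
    ultimately show ?thesis using c(2)[OF x] by auto
  qed
  with c(1) that show ?thesis by blast
qed

section \<open>Surjectivity of \<open>m\<close> from Cauchy-completeness\<close>

text \<open>The weight \<open>str C (m _) f\<close> is right adjoint because \<open>f\<close> is a limit of elements of the image;
  its colimit in \<open>A\<close> is sent to \<open>f\<close>.\<close>

lemma limit_in_image: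
  assumes cc: "cauchy_complete k A" and f: "f \<in> carrier C"
    and lim: "\<And>e. 0 < e \<Longrightarrow> \<exists>a\<in>carrier A. 1 - e < tens k (str C f (m a)) (str C (m a) f)"
  shows "f \<in> m ` carrier A"
proof -
  \<comment> \<open>Index categories are plain \<open>ucat\<close> records, so the operations of
    \<open>A\<close> are dropped.\<close>
  define Z :: "'a ucat" where "Z = \<lparr>carrier = carrier A, str = str A\<rparr>"
  have Z: "carrier Z = carrier A" "str Z = str A" by (simp_all add: Z_def)
  define \<psi> \<phi> where "\<psi> a = str C (m a) f" and "\<phi> a = str C f (m a)" for a
  have tr: "tens k (str C p q) (str C q r) \<le> str C p r"
    if "p \<in> carrier C" "q \<in> carrier C" "r \<in> carrier C" for p q r
    using C_ucategory that by (auto simp: ucategory_def)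
  have \<psi>I: "\<psi> a \<in> I" and \<phi>I: "\<phi> a \<in> I" if "a \<in> carrier A" for a
    unfolding \<psi>_def \<phi>_def using that f m_C C_str_range by blast+
  let ?S = "(\<lambda>a. tens k (\<phi> a) (\<psi> a)) ` carrier A"
  have S: "?S \<subseteq> I" by (intro image_subsetI tens_range \<psi>I \<phi>I)
  have sup: "sup01 ?S = 1"
  proof (rule ccontr)
    assume "sup01 ?S \<noteq> 1"
    then have "0 < 1 - sup01 ?S" using sup01_range[OF S] by auto
    from lim[OF this] sup01_upper[OF S] show False by (force simp: \<psi>_def \<phi>_def)
  qed
  have "ucategory k Z" using A_ucategory by (simp add: ucategory_def Z)
  moreover have "ufunctor Z A id" by (simp add: ufunctor_def Z)
  moreover have "right_adjoint_weight k Z \<psi>"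
    unfolding right_adjoint_weight_def Z
  proof (intro conjI exI[of _ \<phi>] sup ballI)
    show "weight k Z \<psi>" unfolding weight_def Z
      using \<psi>I tr[OF m_C m_C f] by (auto simp: \<psi>_def str_m)
    show "coweight k Z \<phi>" unfolding coweight_def Z
      using \<phi>I tr[OF f m_C m_C] by (auto simp: \<phi>_def str_m)
    show "tens k (\<psi> a) (\<phi> b) \<le> str A a b" if "a \<in> carrier A" "b \<in> carrier A" for a b
      using tr[OF m_C f m_C] that by (auto simp: \<psi>_def \<phi>_def str_m)
  qed
  ultimately obtain c where c: "is_colimit k A Z id \<psi> c"
    using cc unfolding cauchy_complete_def cauchy_complete_over_def by blast
  then have cA: "c \<in> carrier A" by (simp add: is_colimit_def)
  \<comment> \<open>Homs out of the colimit weighted by \<open>\<psi>\<close> are the values of its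
    left adjoint \<open>\<phi>\<close>.\<close>
  have key: "str C (m c) (m a) = str C f (m a)" if a: "a \<in> carrier A" for a
  proof -
    let ?R = "(\<lambda>z. ihom k (\<psi> z) (str A z a)) ` carrier A"
    have R: "?R \<subseteq> I" using a by (intro image_subsetI ihom_range \<psi>I A_str_range)
    have "str C (m c) (m a) = inf01 ?R"
      using c a by (simp add: str_m cA is_colimit_def Z)
    also have "\<dots> = \<phi> a"
    proof (rule eq_inf01I[OF R _ \<phi>I[OF a], symmetric])
      fix v assume v: "v \<in> I"
      have "v \<le> \<phi> a \<longleftrightarrow> (\<forall>z\<in>carrier A. tens k (\<psi> z) v \<le> str A z a)"
      proof
        assume le: "v \<le> \<phi> a"
        show "\<forall>z\<in>carrier A. tens k (\<psi> z) v \<le> str A z a"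
        proof
          fix z assume z: "z \<in> carrier A"
          have "tens k (\<psi> z) v \<le> tens k (\<psi> z) (\<phi> a)"
            using le v a z by (intro tens_mono \<psi>I \<phi>I order_refl)
          also have "\<dots> \<le> str A z a"
            using tr[OF m_C[OF z] f m_C[OF a]] z a by (simp add: \<psi>_def \<phi>_def str_m)
          finally show "tens k (\<psi> z) v \<le> str A z a" .
        qed
      next
        assume le: "\<forall>z\<in>carrier A. tens k (\<psi> z) v \<le> str A z a"
        \<comment> \<open>The values \<open>tens k (\<phi> z) (\<psi> z)\<close> have supremum
          \<open>1\<close>, so \<open>v\<close> is recovered from its tensor products with
          them.\<close>
        have "tens k v (tens k (\<phi> z) (\<psi> z)) \<le> \<phi> a" if z: "z \<in> carrier A" for z
        proof -
          have "tens k v (tens k (\<phi> z) (\<psi> z)) = tens k (\<phi> z) (tens k (\<psi> z) v)"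
            using tens_assoc[OF \<phi>I[OF z] \<psi>I[OF z] v, of k] by (simp add: tens_comm)
          also have "\<dots> \<le> tens k (\<phi> z) (str A z a)"
            using le v a z by (intro tens_mono tens_range \<psi>I \<phi>I A_str_range order_refl) auto
          also have "\<dots> \<le> \<phi> a"
            using tr[OF f m_C[OF z] m_C[OF a]] z a by (simp add: \<phi>_def str_m)
          finally show ?thesis .
        qed
        then have "tens k v (sup01 ?S) \<le> \<phi> a"
          using tens_sup01_le_iff[OF S v \<phi>I[OF a], of k] by blast
        then show "v \<le> \<phi> a" by (simp only: sup tens_one v)
      qed
      also have "\<dots> \<longleftrightarrow> (\<forall>z\<in>carrier A. v \<le> ihom k (\<psi> z) (str A z a))"
        using v a by (intro ball_cong refl ihom_adj \<psi>I A_str_range)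
      finally show "v \<le> \<phi> a \<longleftrightarrow> (\<forall>s\<in>?R. v \<le> s)" by auto
    qed
    finally show ?thesis by (simp add: \<phi>_def)
  qed
  have "str C f (m c) = 1"
    using key[OF cA] C_ucategory m_C[OF cA] by (simp add: ucategory_def)
  moreover have "str C (m c) f = 1"
  proof -
    have I: "str C (m c) f \<in> I" using f cA by (intro C_str_range m_C)
    \<comment> \<open>\<open>key\<close> replaces \<open>\<phi> a\<close> by
      \<open>str C (m c) (m a)\<close>, and composition of homs bounds each member of
      \<open>?S\<close>.\<close>
    have "sup01 ?S \<le> str C (m c) f"
    proof (subst sup01_le_iff[OF S])
      show "\<forall>s\<in>?S. s \<le> str C (m c) f"
        using tr[OF m_C[OF cA] m_C f] key by (auto simp: \<psi>_def \<phi>_def)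
    qed (use I in auto)
    with sup I show ?thesis by auto
  qed
  ultimately have "f = m c"
    using C_separated f m_C[OF cA] by (auto simp: separated_def nat_le_def)
  with cA show ?thesis by blast
qed

text \<open>Uniform distance \<open>d\<close> makes both homs between \<open>f\<close> and
  \<open>m a\<close> at least \<open>1 - 2 * d\<close>; for multiplication the bound
  \<open>1/2\<close> keeps the quotients under control near \<open>0\<close>.\<close>

lemma in_image_if_bounded_below:
  assumes cc: "cauchy_complete k A" and f: "f \<in> carrier C"
    and ge: "\<And>x. k = Multiplication \<Longrightarrow> x \<in> T \<Longrightarrow> 1/2 \<le> f x"
  shows "f \<in> m ` carrier A"
proof (rule limit_in_image[OF cc f])
  fix e :: real assume e: "0 < e"
  \<comment> \<open>With \<open>e / 5\<close> the total loss \<open>4 * d\<close> of the two homs is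
    smaller than \<open>e\<close>.\<close>
  define d where "d = min (e / 5) (1 / 2)"
  have d: "0 < d" "d \<le> e / 5" "d \<le> 1 / 2" using e by (auto simp: d_def)
  obtain a where a: "a \<in> carrier A" "\<And>x. x \<in> T \<Longrightarrow> \<bar>m a x - f x\<bar> \<le> d"
    by (rule uniformly_dense[OF f d(1)]) blast
  \<comment> \<open>The condition on \<open>{p, q}\<close> treats both directions at once.\<close>
  have le: "1 - 2 * d \<le> str C p q"
    if p: "p \<in> carrier C" and q: "q \<in> carrier C" and pq: "{p, q} = {f, m a}" for p q
    unfolding str_eq
  proof (subst inf01_ge_iff)
    show "(\<lambda>x. ihom k (p x) (q x)) ` T \<subseteq> I"
      using p q by (intro image_subsetI ihom_range C_range)
    show "\<forall>s\<in>(\<lambda>x. ihom k (p x) (q x)) ` T. 1 - 2 * d \<le> s"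
    proof safe
      fix x assume x: "x \<in> T"
      show "1 - 2 * d \<le> ihom k (p x) (q x)"
      proof (rule ihom_near_one)
        show "p x - q x \<le> d" using a(2)[OF x] pq d by (auto simp: doubleton_eq_iff)
        show "1 / 2 \<le> max (p x) (q x)" if "k = Multiplication"
          using ge[OF that x] pq by (auto simp: doubleton_eq_iff)
      qed (use p q x d C_range in auto)
    qed
  qed (use d in auto)
  note mC = m_C[OF a(1)]
  have "1 - e < (1 - 2 * d) + (1 - 2 * d) - 1" using d by simp
  also have "\<dots> \<le> str C f (m a) + str C (m a) f - 1"
    using le[OF f mC] le[OF mC f] by (auto simp: insert_commute)
  also have "\<dots> \<le> tens k (str C f (m a)) (str C (m a) f)"
    using f mC by (intro tens_lower_bound C_str_range)
  finally show "\<exists>a\<in>carrier A. 1 - e < tens k (str C f (m a)) (str C (m a) f)"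
    using a(1) by blast
qed

text \<open>For multiplication, \<open>f\<close> is recovered from \<open>(f + 1) / 2\<close>, which is bounded away from \<open>0\<close>, by
  applying \<open>_ \<ominus> 1/2\<close> and then taking the \<open>1/2\<close>-power.\<close>

lemma surjective_if_cauchy_complete:
  assumes cc: "cauchy_complete k A"
  shows "carrier C \<subseteq> m ` carrier A"
proof
  fix f assume f: "f \<in> carrier C"
  show "f \<in> m ` carrier A"
  proof (cases k)
    case Lukasiewicz
    then show ?thesis using in_image_if_bounded_below[OF cc f] by simp
  next
    case Multiplication
    let ?f = "\<lambda>x\<in>T. (\<lambda>u. (u + 1) / 2) (f x)"
    have "?f \<in> carrier C"
      by (rule C_compose[OF f]) (auto intro!: continuous_intros mono_onI)
    then have "?f \<in> m ` carrier A"
    proof (rule in_image_if_bounded_below[OF cc])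
      show "1 / 2 \<le> ?f x" if "x \<in> T" for x using C_range[OF f that] that by simp
    qed
    then obtain a where a: "a \<in> carrier A" "m a = ?f" by auto
    let ?b = "ominus A a (1/2)"
    have b: "?b \<in> carrier A" "m ?b = ominus C (m a) (1/2)"
      using A m a(1) Multiplication
      by (auto simp: A_obj_def A_mor_def Mon_ominus_obj_def Mon_ominus_mor_def)
    have mb: "m ?b x = f x / 2" if "x \<in> T" for x
      using C_range[OF f that] that unfolding b(2) a(2) by (simp add: C_alg_def field_simps)
    \<comment> \<open>\<open>ihom Multiplication (1/2) (f x / 2)\<close> is \<open>f x\<close>, also
      for \<open>f x = 1\<close>, where the truncated branch of the quotient formula
      applies.\<close>
    obtain p where p: "p \<in> carrier A" "\<And>x. x \<in> T \<Longrightarrow> m p x = ihom k (1/2) (m ?b x)"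
      by (rule power_exists[OF b(1), of "1/2"]) auto
    have "m p = f"
    proof (rule C_eqI[OF m_C[OF p(1)] f])
      show "m p x = f x" if "x \<in> T" for x
        using C_range[OF f that] p(2)[OF that] mb[OF that] Multiplication
        by (auto simp: ihom_Multiplication)
    qed
    with p(1) show ?thesis by blast
  qed
qed

section \<open>Inverse morphism and transfer of Cauchy-completeness\<close>

lemma iso_if_surjective:
  assumes surj: "carrier C \<subseteq> m ` carrier A"
  shows "A_iso k A C m"
proof -
  define g where "g = inv_into (carrier A) m"
  have gA: "g f \<in> carrier A" and mg: "m (g f) = f" if "f \<in> carrier C" for f
    using surj that unfolding g_def by (auto intro: inv_into_into f_inv_into_f)
  have gm: "g (m a) = a" if "a \<in> carrier A" for a
    using inj that unfolding g_def by simp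
  \<comment> \<open>An identity for \<open>g\<close> can thus be checked after applying
    \<open>m\<close>, where preservation by \<open>m\<close> settles it.\<close>
  have g_eq: "g f = a" if "a \<in> carrier A" "m a = f" for a f using gm that by blast
  \<comment> \<open>\<open>g\<close> inherits full faithfulness from \<open>m\<close>; powers and
    colimits are expressed through \<open>str\<close> and are therefore transported.\<close>
  have str_g: "str A (g f) (g h) = str C f h" if "f \<in> carrier C" "h \<in> carrier C" for f h
    using str_m[of "g f" "g h"] gA mg that by simp
  have str_gl: "str A (g f) a = str C f (m a)" if "f \<in> carrier C" "a \<in> carrier A" for f a
    using str_g[of f "m a"] gm m_C that by simp
  have str_gr: "str A a (g f) = str C (m a) f" if "f \<in> carrier C" "a \<in> carrier A" for f a
    using str_g[of "m a" f] gm m_C that by simp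
  have pow: "preserves_powers k C A g"
    unfolding preserves_powers_def is_power_def by (auto simp: gA str_gr m_C)
  have coc: "finitely_cocontinuous k C A g"
    unfolding finitely_cocontinuous_over_def is_colimit_def weighted_diagram_def ufunctor_def
    by (auto simp: gA str_gl m_C Pi_iff intro!: arg_cong[where f = inf01] image_cong)
  have "FinSup_mor k C A g"
    using coc by (auto simp: FinSup_mor_def ufunctor_def gA str_g)
  moreover have "g (one C) = one A"
    using m_Mon m_one(1) by (intro g_eq) (auto simp: Mon_mor_def)
  moreover have "g (mult C f h) = mult A (g f) (g h)" if "f \<in> carrier C" "h \<in> carrier C" for f h
    using A_Mon m_Mon that gA mg by (intro g_eq) (auto simp: Mon_obj_def Mon_mor_def)
  ultimately have mon: "Mon_mor k C A g" by (simp add: Mon_mor_def)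
  have "A_mor k C A g"
  proof (cases k)
    case Lukasiewicz
    with pow mon show ?thesis by (simp add: A_mor_def)
  next
    case Multiplication
    have "g (ominus C f u) = ominus A (g f) u" if "f \<in> carrier C" "u \<in> I" for f u
      using A m Multiplication that gA mg
      by (intro g_eq) (auto simp: A_obj_def A_mor_def Mon_ominus_obj_def Mon_ominus_mor_def)
    with pow mon Multiplication show ?thesis by (simp add: A_mor_def Mon_ominus_mor_def)
  qed
  then show ?thesis using m mg gm by (auto simp: A_iso_def)
qed

text \<open>The pointwise supremum of the image diagram is continuous, hence a colimit in
  \<open>C\<close>; surjectivity of \<open>m\<close> supplies an element of \<open>A\<close> mapped
  to it.\<close>

lemma cauchy_complete_if_iso:
  assumes iso: "A_iso k A C m"
  shows "cauchy_complete k A"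
  unfolding cauchy_complete_def cauchy_complete_over_def
proof (intro allI impI, elim conjE)
  fix Z :: "'a ucat" and h \<psi>
  assume h: "ufunctor Z A h" and \<psi>: "right_adjoint_weight k Z \<psi>"
  let ?s = "\<lambda>x\<in>T. sup01 ((\<lambda>z. tens k (\<psi> z) ((m \<circ> h) z x)) ` carrier Z)"
  have hA: "h z \<in> carrier A" if "z \<in> carrier Z" for z using h that by (auto simp: ufunctor_def)
  have mh: "ufunctor Z C (m \<circ> h)"
    using h by (auto simp: ufunctor_def m_C str_m Pi_iff)
  then have s: "?s \<in> carrier C" using \<psi> by (rule C_right_adjoint_sup)
  have "is_colimit k C Z (m \<circ> h) \<psi> ?s"
    by (rule C_colimit[OF _ _ s])
      (use mh \<psi> in \<open>auto simp: ufunctor_def right_adjoint_weight_def weight_def\<close>)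
  moreover obtain c where c: "c \<in> carrier A" "m c = ?s"
  proof -
    obtain g where "A_mor k C A g" "\<forall>f\<in>carrier C. m (g f) = f"
      using iso by (auto simp: A_iso_def)
    moreover from this(1) have "g \<in> carrier C \<rightarrow> carrier A"
      by (cases k) (auto simp: A_mor_def Mon_ominus_mor_def Mon_mor_def FinSup_mor_def ufunctor_def)
    ultimately show ?thesis using s that by blast
  qed
  ultimately have "is_colimit k C Z (m \<circ> h) \<psi> (m c)" by simp
  \<comment> \<open>A fully faithful \<open>m\<close> reflects colimits: testing against the
    functions \<open>m x\<close> is the universal property in \<open>A\<close>.\<close>
  then have "is_colimit k A Z h \<psi> c"
    using c(1) hA by (simp add: is_colimit_def m_C flip: str_m cong: image_cong)
  then show "\<exists>x0. is_colimit k A Z h \<psi> x0" ..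
qed

end

theorem theorem7p11:
  fixes k :: tensor
    and X :: "'x pospace"
    and A :: "'a ualg"
    and m :: "'a \<Rightarrow> 'x \<Rightarrow> real"
  assumes "pos_comp X"
    and "A_obj k A"
    and "A_mor k A (C_alg k X) m"
    and "inj_on m (carrier A)"
    and "point_separating X (carrier A) m"
    and "initial_cone X (carrier A) (\<lambda>_. unit_op) m"
  shows "A_iso k A (C_alg k X) m \<longleftrightarrow> cauchy_complete k A"
proof -
  interpret embedded_algebra k X A m by unfold_locales (use assms in blast)+
  show ?thesis
    using cauchy_complete_if_iso iso_if_surjective surjective_if_cauchy_complete by blast
qed

end
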